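(* Let $K$ be an arbitrary field and $n\geq 1$ an integer. Let $X=(x_{ij})_{i,j=1}^n$ be the matrix of standard coordinate functions on the space $\mathrm{Mat}(n)$ of $n\times n$ matrices with entries in $K$, and let the group $U=\mathrm{UT}(n)$ of upper unitriangular matrices act on $\mathrm{Mat}(n)$ by conjugation. Then the field of invariants $K(\mathrm{Mat}(n))^U$ is freely generated over $K$ by the system of polynomials $$\{P_{ik}(X):\ 1\leq i,k\leq n,\ i'<k\}\sqcup\{D_k(X):\ 1\leq k\leq n\}.$$
   Context: For $1\leq i\leq n$ put $i'=n-i+1$. For integers $a,b$, $[a,b]$ denotes the set of integers $i$ with $a\leq i\leq b$ (empty if $a>b$). All minors are taken with rows and columns in increasing order. For an $n\times n$ matrix $X=(x_{ij})$: for a pair $(i,j)$ with $i'\leq j$, $M_{ij}(X)$ is the minor of $X$ of order $i'$ with rows $[i,n]$ and columns $[1,i'-1]\sqcup\{j\}$; for a pair $(j,k)$ with $j\leq k$, $N_{jk}(X)$ is the minor of $X$ of order $k'$ with rows $\{j\}\sqcup[k+1,n]$ and columns $[1,k']$. For $i'<k$ define $$P_{ik}(X)=\sum_{i'\leq j\leq k}M_{ij}(X)N_{jk}(X).$$ For $1\leq k\leq n$, $D_k(X)$ is the lower left corner minor of order $k'$ of $X$ (rows $[k,n]$, columns $[1,k']$). $K(\mathrm{Mat}(n))$ is the field of rational functions on $\mathrm{Mat}(n)$, i.e. the field of rational functions over $K$ in the $n^2$ variables $x_{ij}$. $\mathrm{GL}(n)$ is the general linear group of order $n$ over $K$, and $U=\mathrm{UT}(n)\subset\mathrm{GL}(n)$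 is the subgroup of upper triangular matrices with ones on the diagonal. The group $U$ acts on $\mathrm{Mat}(n)$ by $X\mapsto gXg^{-1}$ and on functions by $(\rho(g)f)(X)=f(g^{-1}Xg)$. $K(\mathrm{Mat}(n))^U$ is the subfield of $U$-invariants, i.e. of those $f\in K(\mathrm{Mat}(n))$ with $\rho(g)f=f$ for all $g\in U$. A field $F\supseteq K$ is freely generated over $K$ by a system of elements if these elements are algebraically independent over $K$ and generate $F$ as a field over $K$.
   Formalization: For finite K and n ≥ 2 the claim fails for the finite group UT(n) over K (e.g. the product of x11 + c·x21 over c in K is invariant), so for general K invariance is required under unitriangular matrices over the algebraic closure of K; invariance under UT(n) over K itself is treated for infinite K. *)

theory Defs
  imports
    "HOL-Library.Poly_Mapping"
    "HOL-Library.Product_Lexorder"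
    "HOL-Computational_Algebra.Fraction_Field"
    "HOL-Algebra.Generated_Fields"
    "HOL-Algebra.Algebraic_Closure_Type"
    "Jordan_Normal_Form.Determinant"
    "Jordan_Normal_Form.Gauss_Jordan_Elimination"
    "Jordan_Normal_Form.DL_Submatrix"
begin

section \<open>Polynomials and rational functions\<close>

type_synonym ('v, 'k) mpoly = "('v \<Rightarrow>\<^sub>0 nat) \<Rightarrow>\<^sub>0 'k"

definition mpoly_vars :: "('v, 'k::zero) mpoly \<Rightarrow> 'v set" where
  "mpoly_vars p = (\<Union>m\<in>Poly_Mapping.keys p. Poly_Mapping.keys m)"

text \<open>Value of a polynomial at \<open>y\<close>, its coefficients being mapped by \<open>c\<close>.\<close>

definition mpoly_eval ::
  "('k::zero \<Rightarrow> 'b::comm_ring_1) \<Rightarrow> ('v \<Rightarrow> 'b) \<Rightarrow> ('v, 'k) mpoly \<Rightarrow> 'b" where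
  "mpoly_eval c y p =
     (\<Sum>m\<in>Poly_Mapping.keys p. c (Poly_Mapping.lookup p m) *
        (\<Prod>v\<in>Poly_Mapping.keys m. y v ^ Poly_Mapping.lookup m v))"

text \<open>
  Rational functions in variables \<open>x\<^sub>i\<^sub>j\<close> with arbitrary natural indices; the field
  \<open>K(Mat(n))\<close> is the subfield \<open>ratfun_Mat n\<close> below. The lexicographic order on pairs of indices
  only serves to obtain that the polynomial ring is an integral domain.
\<close>

type_synonym 'k ratfun = "(nat \<times> nat, 'k) mpoly fract"

definition const :: "'k::field \<Rightarrow> 'k ratfun" where
  "const c = Fract (Poly_Mapping.single 0 c) 1"

definition coord :: "nat \<times> nat \<Rightarrow> 'k::field ratfun" where
  "coord v = Fract (Poly_Mapping.single (Poly_Mapping.single v 1) 1) 1"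

definition adjoin :: "'k::field ratfun set \<Rightarrow> 'k ratfun set" where
  "adjoin S = generate_field ring_of_type_algebra (range const \<union> S)"

definition ratfun_Mat :: "nat \<Rightarrow> 'k::field ratfun set" where
  "ratfun_Mat n = adjoin (coord ` ({1..n} \<times> {1..n}))"

text \<open>
  Value of a rational function at a point \<open>y\<close> with coordinates in a field, the coefficients being
  mapped by the field embedding \<open>c\<close>. It is meaningful if the function has a representation with
  denominator not vanishing at \<open>y\<close>; the value then does not depend on that representation.
\<close>

definition ratfun_eval ::
  "('k::field \<Rightarrow> 'b::field) \<Rightarrow> (nat \<times> nat \<Rightarrow> 'b) \<Rightarrow> 'k ratfun \<Rightarrow> 'b" where
  "ratfun_eval c y f =
     (THE z. \<exists>p q. f = Fract p q \<and> mpoly_eval c y q \<noteq> 0 \<and>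
                   z = mpoly_eval c y p / mpoly_eval c y q)"

definition alg_independent :: "'v set \<Rightarrow> ('v \<Rightarrow> 'k::field ratfun) \<Rightarrow> bool" where
  "alg_independent A f \<longleftrightarrow>
     (\<forall>p. mpoly_vars p \<subseteq> A \<and> mpoly_eval const f p = 0 \<longrightarrow> p = 0)"

definition freely_generated :: "'k::field ratfun set \<Rightarrow> 'v set \<Rightarrow> ('v \<Rightarrow> 'k ratfun) \<Rightarrow> bool" where
  "freely_generated F A f \<longleftrightarrow> alg_independent A f \<and> F = adjoin (f ` A)"


section \<open>Invariants of the unitriangular group\<close>

text \<open>Matrices are indexed from 0 in the library, so \<open>x\<^sub>i\<^sub>j\<close> is the entry at \<open>(i - 1, j - 1)\<close>.\<close>

definition generic_mat :: "nat \<Rightarrow> 'k::field ratfun mat" where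
  "generic_mat n = mat n n (\<lambda>(a, b). coord (Suc a, Suc b))"

definition UT :: "nat \<Rightarrow> 'k::field mat set" where
  "UT n = {g \<in> carrier_mat n n. upper_triangular g \<and> (\<forall>a<n. g $$ (a, a) = 1)}"

text \<open>\<open>(\<rho>(g) f)(X) = f(g\<^sup>-\<^sup>1 X g)\<close>; \<open>mat_inverse g\<close> is \<open>Some\<close> of the inverse for invertible \<open>g\<close>.\<close>

definition rho :: "nat \<Rightarrow> 'k::field mat \<Rightarrow> 'k ratfun \<Rightarrow> 'k ratfun" where
  "rho n g f =
     (let Y = map_mat const (the (mat_inverse g)) * generic_mat n * map_mat const g
      in ratfun_eval const (\<lambda>(i, j). Y $$ (i - 1, j - 1)) f)"

text \<open>Invariants of the abstract group \<open>UT\<^sub>n(K)\<close> of \<open>K\<close>-rational points.\<close>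

definition invariants_points :: "nat \<Rightarrow> 'k::field ratfun set" where
  "invariants_points n = {f \<in> ratfun_Mat n. \<forall>g\<in>UT n. rho n g f = f}"

text \<open>
  Invariants of the algebraic group \<open>UT\<^sub>n\<close>, that is, elements of \<open>K(Mat(n))\<close> fixed by all points of
  the group over the algebraic closure of \<open>K\<close>. For infinite \<open>K\<close> the \<open>K\<close>-rational points are dense
  and the two fields coincide. For finite \<open>K\<close> the group \<open>UT\<^sub>n(K)\<close> is finite, and for \<open>n \<ge> 2\<close> its
  field of invariants has transcendence degree \<open>n\<^sup>2 > n (n + 1) / 2\<close>.
\<close>

definition base_change :: "'k::field ratfun \<Rightarrow> 'k alg_closure ratfun" where
  "base_change = ratfun_eval (\<lambda>c. const (to_ac c)) coord"

definition invariants :: "nat \<Rightarrow> 'k::field ratfun set" where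
  "invariants n =
     {f \<in> ratfun_Mat n. \<forall>g\<in>UT n. rho n g (base_change f) = base_change f}"


section \<open>The generators\<close>

definition opp :: "nat \<Rightarrow> nat \<Rightarrow> nat" where
  "opp n i = n - i + 1"

text \<open>The minor with (1-based) row set \<open>R\<close> and column set \<open>C\<close>, both in increasing order.\<close>

definition minor :: "'a::comm_ring_1 mat \<Rightarrow> nat set \<Rightarrow> nat set \<Rightarrow> 'a" where
  "minor A R C = det (submatrix A {a. Suc a \<in> R} {b. Suc b \<in> C})"

definition minor_M :: "nat \<Rightarrow> 'a::comm_ring_1 mat \<Rightarrow> nat \<Rightarrow> nat \<Rightarrow> 'a" where
  "minor_M n A i j = minor A {i..n} ({1..opp n i - 1} \<union> {j})"

definition minor_N :: "nat \<Rightarrow> 'a::comm_ring_1 mat \<Rightarrow> nat \<Rightarrow> nat \<Rightarrow> 'a" where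
  "minor_N n A j k = minor A ({j} \<union> {k+1..n}) {1..opp n k}"

definition poly_P :: "nat \<Rightarrow> 'a::comm_ring_1 mat \<Rightarrow> nat \<Rightarrow> nat \<Rightarrow> 'a" where
  "poly_P n A i k = (\<Sum>j\<in>{opp n i..k}. minor_M n A i j * minor_N n A j k)"

definition minor_D :: "nat \<Rightarrow> 'a::comm_ring_1 mat \<Rightarrow> nat \<Rightarrow> 'a" where
  "minor_D n A k = minor A {k..n} {1..opp n k}"

end

theory Submission
  imports Defs
begin

text \<open>
  For fixed \<open>i\<close> and \<open>k\<close> the minors \<open>M\<^sub>i\<^sub>j\<close> form a row vector \<open>m\<^sub>i = w\<^sub>i X\<close> and the minors \<open>N\<^sub>j\<^sub>k\<close> a column
  vector \<open>n\<^sub>k = X v\<^sub>k\<close>, where \<open>w\<^sub>i\<close> and \<open>v\<^sub>k\<close> consist of cofactors. Under \<open>X \<mapsto> g\<^sup>-\<^sup>1 X g\<close> they become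
  \<open>m\<^sub>i g\<close> and \<open>g\<^sup>-\<^sup>1 n\<^sub>k\<close>, so that \<open>P\<^sub>i\<^sub>k = m\<^sub>i n\<^sub>k\<close> is invariant, and so is \<open>D\<^sub>k\<close>. The vectors \<open>n\<^sub>k / D\<^sub>k\<close> are the
  columns of a unitriangular matrix \<open>u\<close>, and \<open>Y = u\<^sup>-\<^sup>1 X u\<close> vanishes above the antidiagonal. On such
  matrices \<open>D\<^sub>k = \<plusminus> y\<^sub>k\<^sub>k\<^sub>' D\<^sub>k\<^sub>+\<^sub>1\<close> and \<open>P\<^sub>i\<^sub>k = D\<^sub>i D\<^sub>k y\<^sub>i\<^sub>k / y\<^sub>i\<^sub>i\<^sub>'\<close>. Hence the values of the generators can be
  prescribed arbitrarily (with \<open>D\<^sub>k \<noteq> 0\<close>), which gives algebraic independence, and the entries of \<open>Y\<close> lie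
  in the field \<open>E\<close> of the generators. An invariant function takes the same value at \<open>X\<close> and at \<open>Y\<close>: the
  identity \<open>f(h\<^sup>-\<^sup>1 X h) = f(X)\<close> holds for the constant points \<open>h\<close> of the group over an infinite field, thus
  by density for \<open>h\<close> with coefficients in \<open>K(Mat(n))\<close>.
\<close>

section \<open>Minors with one varying row\<close>

text \<open>Serves both kinds of minors: a varying row directly, a varying column after transposing
  the block. Row \<open>r\<close> of \<open>b\<close> is overwritten by \<open>y\<close>, so its own
  entries do not influence the value.\<close>

definition row_det :: "nat \<Rightarrow> nat \<Rightarrow> (nat \<Rightarrow> nat \<Rightarrow> 'a::comm_ring_1) \<Rightarrow> (nat \<Rightarrow> 'a) \<Rightarrow> 'a" where
  "row_det m r b y = det (mat m m (\<lambda>(r', c). if r' = r then y c else b r' c))"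

definition row_cof :: "nat \<Rightarrow> nat \<Rightarrow> (nat \<Rightarrow> nat \<Rightarrow> 'a::comm_ring_1) \<Rightarrow> nat \<Rightarrow> 'a" where
  "row_cof m r b c = cofactor (mat m m (\<lambda>(r', c). b r' c)) r c"

text \<open>The two matrices differ in row \<open>r\<close> only, and the cofactor deletes that row.
  This makes \<open>row_det\<close> linear in \<open>y\<close> with fixed coefficients.\<close>

lemma cofactor_replaced_row:
  assumes "r < m" "c < m"
  shows "cofactor (mat m m (\<lambda>(r', c). if r' = r then y c else b r' c)) r c = row_cof m r b c"
proof -
  have "mat_delete (mat m m (\<lambda>(r', c). if r' = r then y c else b r' c)) r c
      = mat_delete (mat m m (\<lambda>(r', c). b r' c)) r c"
    using assms by (intro eq_matI) (auto simp: mat_delete_def)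
  then show ?thesis by (simp add: row_cof_def cofactor_def)
qed

lemma row_det_laplace:
  assumes "r < m"
  shows "row_det m r b y = (\<Sum>c<m. y c * row_cof m r b c)"
proof -
  let ?T = "mat m m (\<lambda>(r', c). if r' = r then y c else b r' c)"
  have "det ?T = (\<Sum>c<m. ?T $$ (r, c) * cofactor ?T r c)"
    using assms by (intro laplace_expansion_row) auto
  also have "\<dots> = (\<Sum>c<m. y c * row_cof m r b c)"
    using assms by (intro sum.cong) (auto simp: cofactor_replaced_row)
  finally show ?thesis by (simp add: row_det_def)
qed

lemma row_det_same_row:
  assumes "r < m" "r' < m" "r \<noteq> r'" "\<And>c. c < m \<Longrightarrow> y c = b r' c"
  shows "row_det m r b y = 0"
  unfolding row_det_def
  by (rule det_identical_rows[of _ m r r']) (use assms in \<open>auto intro!: eq_vecI\<close>)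

text \<open>Cramer's rule. \<open>x\<close> solves \<open>T x = d e_r\<close>, where
  \<open>T\<close> has \<open>y0\<close> as row \<open>r\<close> and determinant \<open>d\<close>.
  Multiplying by the adjugate and cancelling \<open>d\<close> shows that \<open>x\<close> consists
  of the cofactors along row \<open>r\<close>, which are the same for every
  \<open>y\<close>.\<close>

lemma row_det_unique:
  fixes b :: "nat \<Rightarrow> nat \<Rightarrow> 'a::field"
  assumes r: "r < m"
    and ker: "\<And>r'. r' < m \<Longrightarrow> r' \<noteq> r \<Longrightarrow> (\<Sum>c<m. b r' c * x c) = 0"
    and norm: "(\<Sum>c<m. y0 c * x c) = row_det m r b y0"
    and nz: "row_det m r b y0 \<noteq> 0"
  shows "row_det m r b y = (\<Sum>c<m. y c * x c)"
proof -
  define T where "T = mat m m (\<lambda>(r', c). if r' = r then y0 c else b r' c)"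
  define d where "d = det T"
  have T: "T \<in> carrier_mat m m" by (simp add: T_def)
  have d: "d = row_det m r b y0" by (simp add: d_def T_def row_det_def)
  have x: "x k = row_cof m r b k" if k: "k < m" for k
  proof -
    have Tx: "(\<Sum>c<m. T $$ (s, c) * x c) = (if s = r then d else 0)" if "s < m" for s
    proof -
      have "(\<Sum>c<m. T $$ (s, c) * x c) = (\<Sum>c<m. (if s = r then y0 c else b s c) * x c)"
        using that by (intro sum.cong) (auto simp: T_def)
      then show ?thesis using ker[OF that] norm d by auto
    qed
    have "d * x k = (\<Sum>c<m. (d \<cdot>\<^sub>m 1\<^sub>m m) $$ (k, c) * x c)"
      using k by (simp add: if_distrib[of "\<lambda>z. z * _"] if_distrib[of "\<lambda>z. _ * z"] sum.delta cong: if_cong)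
    also have "\<dots> = (\<Sum>c<m. (adj_mat T * T) $$ (k, c) * x c)"
      using adj_mat(3)[OF T] by (simp add: d_def)
    also have "\<dots> = (\<Sum>c<m. (\<Sum>s<m. adj_mat T $$ (k, s) * T $$ (s, c)) * x c)"
      using k T adj_mat(1)[OF T]
      by (intro sum.cong) (auto simp: scalar_prod_def atLeast0LessThan)
    also have "\<dots> = (\<Sum>s<m. adj_mat T $$ (k, s) * (\<Sum>c<m. T $$ (s, c) * x c))"
      unfolding sum_distrib_left sum_distrib_right
      by (subst sum.swap) (simp add: mult.assoc)
    also have "\<dots> = (\<Sum>s<m. adj_mat T $$ (k, s) * (if s = r then d else 0))"
      by (intro sum.cong) (auto simp: Tx)
    also have "\<dots> = adj_mat T $$ (k, r) * d"
      using r by (simp add: if_distrib[of "\<lambda>z. _ * z"] sum.delta cong: if_cong)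
    also have "adj_mat T $$ (k, r) = row_cof m r b k"
      using k r T by (simp add: adj_mat_def T_def cofactor_replaced_row)
    finally show ?thesis using nz d by simp
  qed
  show ?thesis unfolding row_det_laplace[OF r] by (intro sum.cong) (auto simp: x)
qed

text \<open>
  In 0-based indexing these are \<open>D\<^sub>k\<close>, \<open>N\<^sub>j\<^sub>k\<close>, \<open>M\<^sub>i\<^sub>j\<close> and \<open>P\<^sub>i\<^sub>k\<close>. They are defined for all row indices \<open>j\<close>
  (column indices \<open>j\<close>) with the varying line put first (last); outside the range of the paper two
  lines coincide and the minor is 0, so that the sum in \<open>pairing\<close> is a full matrix product.
\<close>

definition low_minor :: "nat \<Rightarrow> 'a::comm_ring_1 mat \<Rightarrow> nat \<Rightarrow> 'a" where
  "low_minor n A k = det (mat (n - k) (n - k) (\<lambda>(r, c). A $$ (k + r, c)))"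

definition row_minor :: "nat \<Rightarrow> 'a::comm_ring_1 mat \<Rightarrow> nat \<Rightarrow> nat \<Rightarrow> 'a" where
  "row_minor n A j k = row_det (n - k) 0 (\<lambda>r c. A $$ (k + r, c)) (\<lambda>c. A $$ (j, c))"

definition col_minor :: "nat \<Rightarrow> 'a::comm_ring_1 mat \<Rightarrow> nat \<Rightarrow> nat \<Rightarrow> 'a" where
  "col_minor n A i j = row_det (n - i) (n - i - 1) (\<lambda>c r. A $$ (i + r, c)) (\<lambda>r. A $$ (i + r, j))"

definition pairing :: "nat \<Rightarrow> 'a::comm_ring_1 mat \<Rightarrow> nat \<Rightarrow> nat \<Rightarrow> 'a" where
  "pairing n A i k = (\<Sum>j\<in>{n - 1 - i..k}. col_minor n A i j * row_minor n A j k)"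

text \<open>Column \<open>k\<close> is the vector \<open>v_k\<close>, and row \<open>i\<close> of
  \<open>col_cofs\<close> is \<open>w_i\<close>, both padded by zeros to length \<open>n\<close> so
  that the minors become entries of full products with \<open>A\<close>.\<close>

definition row_cofs :: "nat \<Rightarrow> 'a::comm_ring_1 mat \<Rightarrow> 'a mat" where
  "row_cofs n A = mat n n (\<lambda>(c, k). if c < n - k then row_cof (n - k) 0 (\<lambda>r c. A $$ (k + r, c)) c else 0)"

definition col_cofs :: "nat \<Rightarrow> 'a::comm_ring_1 mat \<Rightarrow> 'a mat" where
  "col_cofs n A = mat n n (\<lambda>(i, a). if i \<le> a
     then row_cof (n - i) (n - i - 1) (\<lambda>c r. A $$ (i + r, c)) (a - i) else 0)"

lemma low_minor_eq_row_minor: "low_minor n A k = row_minor n A k k"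
  unfolding low_minor_def row_minor_def row_det_def
  by (rule arg_cong[of _ _ det]) (auto intro!: eq_matI)

text \<open>\<open>col_minor\<close> is defined through the transposed block, whence the
  transposition here.\<close>

lemma low_minor_eq_col_minor: "low_minor n A i = col_minor n A i (n - 1 - i)"
proof -
  have "low_minor n A i = det (transpose_mat (mat (n - i) (n - i) (\<lambda>(r, c). A $$ (i + r, c))))"
    unfolding low_minor_def by (rule det_transpose[symmetric]) auto
  also have "\<dots> = col_minor n A i (n - 1 - i)"
    unfolding col_minor_def row_det_def
    by (rule arg_cong[of _ _ det]) (auto intro!: eq_matI)
  finally show ?thesis .
qed

text \<open>The empty determinant. It starts the downward recursion for the corner minors.\<close>

lemma low_minor_full: "low_minor n A n = 1"
  by (simp add: low_minor_def)

lemma row_minor_below: "k < j \<Longrightarrow> j < n \<Longrightarrow> row_minor n A j k = 0"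
  unfolding row_minor_def by (rule row_det_same_row[of _ _ "j - k"]) auto

lemma col_minor_left: "i < n \<Longrightarrow> j < n - 1 - i \<Longrightarrow> col_minor n A i j = 0"
  unfolding col_minor_def by (rule row_det_same_row[of _ _ j]) auto

section \<open>Minors as entries of matrix products\<close>

lemma mult_mat_index:
  assumes "A \<in> carrier_mat n n" "B \<in> carrier_mat n n" "i < n" "j < n"
  shows "(A * B) $$ (i, j) = (\<Sum>l<n. A $$ (i, l) * B $$ (l, j))"
  using assms by (simp add: scalar_prod_def atLeast0LessThan)

lemma sum_head:
  fixes f :: "nat \<Rightarrow> 'a::comm_monoid_add"
  assumes "k \<le> n" "\<And>l. l < n \<Longrightarrow> k \<le> l \<Longrightarrow> f l = 0"
  shows "(\<Sum>l<n. f l) = (\<Sum>l<k. f l)"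
  by (rule sum.mono_neutral_right) (use assms in auto)

lemma sum_tail:
  fixes f :: "nat \<Rightarrow> 'a::comm_monoid_add"
  assumes "k \<le> n" "\<And>l. l < k \<Longrightarrow> f l = 0"
  shows "(\<Sum>l<n. f l) = (\<Sum>l<n - k. f (k + l))"
proof -
  have "(\<Sum>l<n. f l) = (\<Sum>l\<in>{k..<n}. f l)"
    by (rule sum.mono_neutral_right) (use assms in auto)
  also have "\<dots> = (\<Sum>l<n - k. f (k + l))"
    using assms(1) by (intro sum.reindex_bij_witness[of _ "\<lambda>l. k + l" "\<lambda>l. l - k"]) auto
  finally show ?thesis .
qed

lemma row_cofs_carrier [simp]: "row_cofs n A \<in> carrier_mat n n"
  by (simp add: row_cofs_def)

lemma col_cofs_carrier [simp]: "col_cofs n A \<in> carrier_mat n n"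
  by (simp add: col_cofs_def)

lemma mult_row_cofs:
  assumes A: "A \<in> carrier_mat n n" and "j < n" "k < n"
  shows "(A * row_cofs n A) $$ (j, k) = row_minor n A j k"
proof -
  have "(A * row_cofs n A) $$ (j, k) = (\<Sum>c<n. A $$ (j, c) * row_cofs n A $$ (c, k))"
    using assms by (intro mult_mat_index) auto
  also have "\<dots> = (\<Sum>c<n - k. A $$ (j, c) * row_cofs n A $$ (c, k))"
    using assms by (intro sum_head) (auto simp: row_cofs_def)
  also have "\<dots> = row_minor n A j k"
    unfolding row_minor_def using assms
    by (subst row_det_laplace) (auto simp: row_cofs_def intro!: sum.cong)
  finally show ?thesis .
qed

lemma mult_col_cofs:
  assumes A: "A \<in> carrier_mat n n" and "i < n" "j < n"
  shows "(col_cofs n A * A) $$ (i, j) = col_minor n A i j"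
proof -
  have "(col_cofs n A * A) $$ (i, j) = (\<Sum>a<n. col_cofs n A $$ (i, a) * A $$ (a, j))"
    using assms by (intro mult_mat_index) auto
  also have "\<dots> = (\<Sum>a<n - i. col_cofs n A $$ (i, i + a) * A $$ (i + a, j))"
    using assms by (intro sum_tail) (auto simp: col_cofs_def)
  also have "\<dots> = col_minor n A i j"
    unfolding col_minor_def using assms
    by (subst row_det_laplace) (auto simp: col_cofs_def mult.commute intro!: sum.cong)
  finally show ?thesis .
qed

text \<open>
  The vanishing conditions and the normalization determine column \<open>k\<close> of \<open>V\<close>, as \<open>low_minor n A k\<close> is the
  determinant of the linear system. Hence the behaviour of the minors under conjugation need not be
  computed: it suffices to exhibit a suitable \<open>V\<close>.
\<close>

lemma row_minor_unique:
  fixes A :: "'a::field mat"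
  assumes A: "A \<in> carrier_mat n n" and V: "V \<in> carrier_mat n n" and jk: "j < n" "k < n"
    and supp: "\<And>c. c < n \<Longrightarrow> n \<le> c + k \<Longrightarrow> V $$ (c, k) = 0"
    and ker: "\<And>l. k < l \<Longrightarrow> l < n \<Longrightarrow> (A * V) $$ (l, k) = 0"
    and norm: "(A * V) $$ (k, k) = low_minor n A k" and nz: "low_minor n A k \<noteq> 0"
  shows "row_minor n A j k = (A * V) $$ (j, k)"
proof -
  have AV: "(A * V) $$ (l, k) = (\<Sum>c<n - k. A $$ (l, c) * V $$ (c, k))" if "l < n" for l
    unfolding mult_mat_index[OF A V that jk(2)] using jk by (intro sum_head) (auto simp: supp)
  show ?thesis unfolding row_minor_def AV[OF jk(1)]
  proof (rule row_det_unique[where ?y0.0 = "\<lambda>c. A $$ (k, c)"])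
    show "(\<Sum>c<n - k. A $$ (k + r', c) * V $$ (c, k)) = 0" if "r' < n - k" "r' \<noteq> 0" for r'
      using ker[of "k + r'"] AV[of "k + r'"] that by auto
    show "(\<Sum>c<n - k. A $$ (k, c) * V $$ (c, k)) = row_det (n - k) 0 (\<lambda>r c. A $$ (k + r, c)) (\<lambda>c. A $$ (k, c))"
      using norm AV[OF jk(2)] by (simp add: low_minor_eq_row_minor row_minor_def)
    show "row_det (n - k) 0 (\<lambda>r c. A $$ (k + r, c)) (\<lambda>c. A $$ (k, c)) \<noteq> 0"
      using nz by (simp add: low_minor_eq_row_minor row_minor_def)
  qed (use jk in auto)
qed

text \<open>The transposed counterpart: row \<open>i\<close> of \<open>W\<close> is determined. The
  normalization sits on the antidiagonal because \<open>low_minor n A i\<close> is the column minor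
  with \<open>j = n - 1 - i\<close>.\<close>

lemma col_minor_unique:
  fixes A :: "'a::field mat"
  assumes A: "A \<in> carrier_mat n n" and W: "W \<in> carrier_mat n n" and ij: "i < n" "j < n"
    and supp: "\<And>a. a < i \<Longrightarrow> W $$ (i, a) = 0"
    and ker: "\<And>l. l < n - 1 - i \<Longrightarrow> (W * A) $$ (i, l) = 0"
    and norm: "(W * A) $$ (i, n - 1 - i) = low_minor n A i" and nz: "low_minor n A i \<noteq> 0"
  shows "col_minor n A i j = (W * A) $$ (i, j)"
proof -
  have WA: "(W * A) $$ (i, l) = (\<Sum>r<n - i. A $$ (i + r, l) * W $$ (i, i + r))" if "l < n" for l
    unfolding mult_mat_index[OF W A ij(1) that]
    using ij by (subst sum_tail[of i]) (auto simp: supp mult.commute)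
  show ?thesis unfolding col_minor_def WA[OF ij(2)]
  proof (rule row_det_unique[where ?y0.0 = "\<lambda>r. A $$ (i + r, n - 1 - i)"])
    show "(\<Sum>c<n - i. A $$ (i + c, r') * W $$ (i, i + c)) = 0" if "r' < n - i" "r' \<noteq> n - i - 1" for r'
      using ker[of "r'"] WA[of "r'"] that by auto
    show "(\<Sum>c<n - i. A $$ (i + c, n - 1 - i) * W $$ (i, i + c))
        = row_det (n - i) (n - i - 1) (\<lambda>c r. A $$ (i + r, c)) (\<lambda>r. A $$ (i + r, n - 1 - i))"
      using norm WA[of "n - 1 - i"] ij by (simp add: low_minor_eq_col_minor col_minor_def)
    show "row_det (n - i) (n - i - 1) (\<lambda>c r. A $$ (i + r, c)) (\<lambda>r. A $$ (i + r, n - 1 - i)) \<noteq> 0"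
      using nz by (simp add: low_minor_eq_col_minor col_minor_def)
  qed (use ij in auto)
qed

text \<open>Outside \<open>{n - 1 - i..k}\<close> one of the two minors vanishes, so the truncated
  sum is a full matrix product. Only row \<open>i\<close> of \<open>B\<close> and column
  \<open>k\<close> of \<open>C\<close> have to match the minors, which leaves freedom in choosing
  both matrices.\<close>

lemma pairing_eq_mult:
  assumes ik: "i < n" "k < n" and B: "B \<in> carrier_mat n n" and C: "C \<in> carrier_mat n n"
    and "\<And>j. j < n \<Longrightarrow> col_minor n A i j = B $$ (i, j)"
    and "\<And>j. j < n \<Longrightarrow> row_minor n A j k = C $$ (j, k)"
  shows "pairing n A i k = (B * C) $$ (i, k)"
proof -
  have "(B * C) $$ (i, k) = (\<Sum>j<n. col_minor n A i j * row_minor n A j k)"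
    unfolding mult_mat_index[OF B C ik] using assms by (intro sum.cong) auto
  also have "\<dots> = pairing n A i k"
    unfolding pairing_def
  proof (rule sum.mono_neutral_right)
    show "\<forall>j\<in>{..<n} - {n - 1 - i..k}. col_minor n A i j * row_minor n A j k = 0"
    proof
      fix j assume "j \<in> {..<n} - {n - 1 - i..k}"
      then have "j < n" "j < n - 1 - i \<or> k < j" by auto
      then show "col_minor n A i j * row_minor n A j k = 0"
        using row_minor_below[of k j n A] col_minor_left[of i n j A] ik by auto
    qed
  qed (use ik in auto)
  finally show ?thesis by simp
qed

section \<open>Conjugation by unitriangular matrices and the section\<close>

lemma UT_carrier: "g \<in> UT n \<Longrightarrow> g \<in> carrier_mat n n"
  by (simp add: UT_def)

lemma UT_index:
  assumes "g \<in> UT n" "a < n" "b \<le> a"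
  shows "g $$ (a, b) = (if a = b then 1 else 0)"
  using assms by (auto simp: UT_def upper_triangular_def)

lemma UT_I:
  assumes "g \<in> carrier_mat n n" "\<And>a b. a < n \<Longrightarrow> b \<le> a \<Longrightarrow> g $$ (a, b) = (if a = b then 1 else 0)"
  shows "g \<in> UT n"
  using assms by (auto simp: UT_def upper_triangular_def)

lemma det_upper_unitriangular:
  assumes "A \<in> carrier_mat n n" "\<And>a b. a < n \<Longrightarrow> b \<le> a \<Longrightarrow> A $$ (a, b) = (if a = b then 1 else 0)"
  shows "det A = 1"
proof -
  have "det A = prod_list (diag_mat A)"
    by (rule det_upper_triangular) (use assms in \<open>auto simp: upper_triangular_def\<close>)
  also have "diag_mat A = map (\<lambda>_. 1) [0..<n]"
    using assms by (auto simp: diag_mat_def)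
  finally show ?thesis by (simp add: map_replicate_const)
qed

lemma det_UT: "g \<in> UT n \<Longrightarrow> det g = 1"
  by (rule det_upper_unitriangular[of _ n]) (auto simp: UT_index UT_carrier)

lemma UT_mult:
  assumes "g \<in> UT n" "h \<in> UT n"
  shows "g * h \<in> UT n"
proof (rule UT_I)
  fix a b assume ab: "a < n" "b \<le> a"
  have "(g * h) $$ (a, b) = (\<Sum>l<n. g $$ (a, l) * h $$ (l, b))"
    using assms ab by (intro mult_mat_index) (auto simp: UT_carrier)
  also have "\<dots> = (\<Sum>l<n. if l = a then (if a = b then 1 else 0) else 0)"
  proof (intro sum.cong refl)
    fix l assume "l \<in> {..<n}"
    then show "g $$ (a, l) * h $$ (l, b) = (if l = a then (if a = b then 1 else 0) else 0)"
      using assms ab UT_index[of g n a l] UT_index[of h n l b]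
      by (cases l a rule: linorder_cases) auto
  qed
  finally show "(g * h) $$ (a, b) = (if a = b then 1 else 0)" using ab by simp
qed (use assms in \<open>simp add: UT_carrier mult_carrier_mat[of _ n n]\<close>)

lemma adj_mat_UT:
  assumes h: "h \<in> UT n"
  shows "adj_mat h * h = 1\<^sub>m n" "h * adj_mat h = 1\<^sub>m n" "adj_mat h \<in> carrier_mat n n"
  using adj_mat[OF UT_carrier[OF h]] det_UT[OF h] by auto

lemma inverse_unique_mat:
  fixes g :: "'a::comm_ring_1 mat"
  assumes "g \<in> carrier_mat n n" "h \<in> carrier_mat n n" "g' \<in> carrier_mat n n"
    and "g * h = 1\<^sub>m n" "h * g' = 1\<^sub>m n"
  shows "g = g'"
proof -
  have "g = g * (h * g')" using assms by simp
  also have "\<dots> = g * h * g'" using assms by (intro assoc_mult_mat[symmetric])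
  also have "\<dots> = g'" using assms by (simp add: left_mult_one_mat[of _ n n])
  finally show ?thesis .
qed

text \<open>Induction from the last row upwards. In entry \<open>(a, b)\<close> of
  \<open>h * adj_mat h\<close> with \<open>b \<le> a\<close>, the terms with \<open>l < a\<close>
  vanish because \<open>h\<close> is triangular and those with \<open>l > a\<close> by the induction
  hypothesis, so only \<open>l = a\<close> is left.\<close>

lemma adj_mat_in_UT:
  assumes h: "h \<in> UT n"
  shows "adj_mat h \<in> UT n"
proof (rule UT_I)
  let ?g = "adj_mat h"
  show g: "?g \<in> carrier_mat n n" using adj_mat_UT[OF h] by simp
  have "\<forall>b\<le>a. ?g $$ (a, b) = (if a = b then 1 else 0)" if "a < n" for a
    using that
  proof (induction "n - a" arbitrary: a rule: less_induct)
    case less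
    show ?case
    proof (intro allI impI)
      fix b assume b: "b \<le> a"
      have "(h * ?g) $$ (a, b) = (\<Sum>l<n. h $$ (a, l) * ?g $$ (l, b))"
        using g less.prems b UT_carrier[OF h] by (intro mult_mat_index) auto
      also have "\<dots> = (\<Sum>l<n. if l = a then ?g $$ (a, b) else 0)"
      proof (intro sum.cong refl)
        fix l assume "l \<in> {..<n}"
        then show "h $$ (a, l) * ?g $$ (l, b) = (if l = a then ?g $$ (a, b) else 0)"
          using less.hyps[of l] less.prems b UT_index[OF h less.prems, of l]
          by (cases l a rule: linorder_cases) auto
      qed
      also have "\<dots> = ?g $$ (a, b)" using less.prems by simp
      finally show "?g $$ (a, b) = (if a = b then 1 else 0)"
        using less.prems b by (simp add: adj_mat_UT[OF h])
    qed
  qed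
  then show "\<And>a b. a < n \<Longrightarrow> b \<le> a \<Longrightarrow> ?g $$ (a, b) = (if a = b then 1 else 0)" by blast
qed

text \<open>Connects the inverse occurring in \<open>rho\<close> with the adjugate used for
  conjugation below.\<close>

lemma mat_inverse_UT:
  assumes h: "(h :: 'a::field mat) \<in> UT n"
  shows "the (mat_inverse h) = adj_mat h"
proof -
  have c: "h \<in> carrier_mat n n" using h by (rule UT_carrier)
  have "h \<in> Units (ring_mat TYPE('a) n ())"
    by (rule det_non_zero_imp_unit[OF c]) (simp add: det_UT[OF h])
  then obtain B where B: "mat_inverse h = Some B"
    using mat_inverse(1)[OF c, of "()"] by (cases "mat_inverse h") auto
  then have "B = adj_mat h"
    using mat_inverse(2)[OF c B] adj_mat_UT[OF h] c by (intro inverse_unique_mat[of B n h]) auto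
  then show ?thesis by (simp add: B)
qed

text \<open>On \<open>UT n\<close> the determinant is 1, so the adjugate is the inverse. Being
  polynomial in the entries, it makes sense over polynomial rings, commutes with ring homomorphisms
  and depends polynomially on parameters.\<close>

definition mat_conj :: "'a::comm_ring_1 mat \<Rightarrow> 'a mat \<Rightarrow> 'a mat" where
  "mat_conj h A = adj_mat h * A * h"

lemma mat_conj_carrier [simp]:
  assumes "h \<in> carrier_mat n n" "A \<in> carrier_mat n n"
  shows "mat_conj h A \<in> carrier_mat n n"
  using assms adj_mat(1)[of h n] by (auto simp: mat_conj_def)

lemma adj_mat_UT_mult:
  assumes g: "g \<in> UT n" and h: "h \<in> UT n"
  shows "adj_mat (g * h) = adj_mat h * adj_mat g"
proof -
  note [simp] = UT_carrier[OF g] UT_carrier[OF h] adj_mat_UT[OF g] adj_mat_UT[OF h]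
  have 1: "g * h * (adj_mat h * adj_mat g) = g * (h * (adj_mat h * adj_mat g))"
    by (rule assoc_mult_mat[of _ n n _ n _ n]) (auto intro!: mult_carrier_mat[of _ n n])
  have 2: "h * (adj_mat h * adj_mat g) = (h * adj_mat h) * adj_mat g"
    by (rule assoc_mult_mat[of _ n n _ n _ n, symmetric]) auto
  show ?thesis
    by (rule inverse_unique_mat[OF adj_mat_UT(3)[OF UT_mult[OF g h]] UT_carrier[OF UT_mult[OF g h]]
          mult_carrier_mat[OF adj_mat_UT(3)[OF h] adj_mat_UT(3)[OF g]] adj_mat_UT(1)[OF UT_mult[OF g h]]])
      (simp add: 1 2 left_mult_one_mat[of _ n n])
qed

text \<open>Conjugation is a right action: the left factor acts first.\<close>

lemma mat_conj_mult:
  assumes g: "g \<in> UT n" and h: "h \<in> UT n" and A: "A \<in> carrier_mat n n"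
  shows "mat_conj (g * h) A = mat_conj h (mat_conj g A)"
proof -
  note [simp] = UT_carrier[OF g] UT_carrier[OF h] adj_mat_UT[OF g] adj_mat_UT[OF h] A
  note [simp] = mult_carrier_mat[of _ n n _ n] left_mult_one_mat[of _ n n] assoc_mult_mat[of _ n n _ n _ n]
  show ?thesis by (simp add: mat_conj_def adj_mat_UT_mult[OF g h])
qed

lemma one_UT: "1\<^sub>m n \<in> UT n"
  by (rule UT_I) auto

lemma mat_conj_one:
  assumes A: "(A :: 'a::field mat) \<in> carrier_mat n n"
  shows "mat_conj (1\<^sub>m n) A = A"
proof -
  have "adj_mat (1\<^sub>m n :: 'a mat) = 1\<^sub>m n"
    using adj_mat_UT[OF one_UT[of n, where ?'a = 'a]] by (simp add: right_mult_one_mat[of _ n n])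
  then show ?thesis using A by (simp add: mat_conj_def)
qed

lemma mat_conj_adj:
  assumes h: "h \<in> UT n" and A: "A \<in> carrier_mat n n"
  shows "mat_conj (adj_mat h) (mat_conj h A) = A" "mat_conj h (mat_conj (adj_mat h) A) = A"
  using mat_conj_mult[OF h adj_mat_in_UT[OF h] A] mat_conj_mult[OF adj_mat_in_UT[OF h] h A]
  by (simp_all add: adj_mat_UT[OF h] mat_conj_one[OF A])

section \<open>Behaviour of the minors under conjugation\<close>

lemma low_minor_mult_left:
  assumes g: "g \<in> UT n" and A: "A \<in> carrier_mat n n" and k: "k < n"
  shows "low_minor n (g * A) k = low_minor n A k"
proof -
  \<comment> \<open>The last \<open>n - k\<close> rows of \<open>g * A\<close> involve only the
    lower right block \<open>g'\<close> of \<open>g\<close>, because \<open>g\<close> is upper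
    triangular; that block is again unitriangular.\<close>
  define m where "m = n - k"
  define B where "B = mat m m (\<lambda>(r, c). A $$ (k + r, c))"
  define g' where "g' = mat m m (\<lambda>(r, c). g $$ (k + r, k + c))"
  have eq: "mat m m (\<lambda>(r, c). (g * A) $$ (k + r, c)) = g' * B"
  proof (rule eq_matI)
    fix r c assume "r < dim_row (g' * B)" "c < dim_col (g' * B)"
    then have rc: "r < m" "c < m" by (auto simp: g'_def B_def)
    have "(g * A) $$ (k + r, c) = (\<Sum>l<n. g $$ (k + r, l) * A $$ (l, c))"
      by (rule mult_mat_index) (use rc k A UT_carrier[OF g] in \<open>auto simp: m_def\<close>)
    also have "\<dots> = (\<Sum>l<m. g $$ (k + r, k + l) * A $$ (k + l, c))"
      unfolding m_def by (rule sum_tail) (use rc k UT_index[OF g] in \<open>auto simp: m_def\<close>)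
    also have "\<dots> = (g' * B) $$ (r, c)"
      using rc by (subst mult_mat_index[of _ m]) (auto simp: g'_def B_def)
    finally show "mat m m (\<lambda>(r, c). (g * A) $$ (k + r, c)) $$ (r, c) = (g' * B) $$ (r, c)"
      using rc by simp
  qed (auto simp: g'_def B_def)
  have "det g' = 1"
    by (rule det_upper_unitriangular[of _ m]) (use k UT_index[OF g] in \<open>auto simp: g'_def m_def\<close>)
  moreover have "low_minor n (g * A) k = det g' * det B"
    unfolding low_minor_def m_def[symmetric] eq by (rule det_mult[of _ m]) (auto simp: g'_def B_def)
  ultimately show ?thesis by (simp add: low_minor_def B_def m_def)
qed

lemma low_minor_mult_right:
  assumes h: "h \<in> UT n" and A: "A \<in> carrier_mat n n" and k: "k < n"
  shows "low_minor n (A * h) k = low_minor n A k"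
proof -
  \<comment> \<open>Dually, the first \<open>n - k\<close> columns of \<open>A * h\<close> involve
    only the upper left block of \<open>h\<close>.\<close>
  define m where "m = n - k"
  define B where "B = mat m m (\<lambda>(r, c). A $$ (k + r, c))"
  define h' where "h' = mat m m (\<lambda>(r, c). h $$ (r, c))"
  have eq: "mat m m (\<lambda>(r, c). (A * h) $$ (k + r, c)) = B * h'"
  proof (rule eq_matI)
    fix r c assume "r < dim_row (B * h')" "c < dim_col (B * h')"
    then have rc: "r < m" "c < m" by (auto simp: h'_def B_def)
    have "(A * h) $$ (k + r, c) = (\<Sum>l<n. A $$ (k + r, l) * h $$ (l, c))"
      by (rule mult_mat_index) (use rc k A UT_carrier[OF h] in \<open>auto simp: m_def\<close>)
    also have "\<dots> = (\<Sum>l<m. A $$ (k + r, l) * h $$ (l, c))"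
      by (rule sum_head) (use rc k UT_index[OF h] in \<open>auto simp: m_def\<close>)
    also have "\<dots> = (B * h') $$ (r, c)"
      using rc by (subst mult_mat_index[of _ m]) (auto simp: h'_def B_def)
    finally show "mat m m (\<lambda>(r, c). (A * h) $$ (k + r, c)) $$ (r, c) = (B * h') $$ (r, c)"
      using rc by simp
  qed (auto simp: h'_def B_def)
  have "det h' = 1"
    by (rule det_upper_unitriangular[of _ m]) (use k UT_index[OF h] in \<open>auto simp: h'_def m_def\<close>)
  moreover have "low_minor n (A * h) k = det B * det h'"
    unfolding low_minor_def m_def[symmetric] eq by (rule det_mult[of _ m]) (auto simp: h'_def B_def)
  ultimately show ?thesis by (simp add: low_minor_def B_def m_def)
qed

lemma low_minor_conj:
  assumes h: "h \<in> UT n" and A: "A \<in> carrier_mat n n" and k: "k < n"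
  shows "low_minor n (mat_conj h A) k = low_minor n A k"
proof -
  have "low_minor n (mat_conj h A) k = low_minor n (adj_mat h * A) k"
    unfolding mat_conj_def
    by (rule low_minor_mult_right[OF h _ k]) (use A adj_mat_UT[OF h] in auto)
  also have "\<dots> = low_minor n A k"
    by (rule low_minor_mult_left[OF adj_mat_in_UT[OF h] A k])
  finally show ?thesis .
qed

text \<open>Left multiplication by \<open>g\<close> adds multiples of lower rows to row
  \<open>j\<close>; these contribute nothing in column \<open>k\<close>.\<close>

lemma UT_mult_left_index:
  assumes g: "g \<in> UT n" and B: "B \<in> carrier_mat n n" and jk: "j < n" "k < n"
    and z: "\<And>l. j < l \<Longrightarrow> l < n \<Longrightarrow> B $$ (l, k) = 0"
  shows "(g * B) $$ (j, k) = B $$ (j, k)"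
proof -
  have "(g * B) $$ (j, k) = (\<Sum>l<n. g $$ (j, l) * B $$ (l, k))"
    by (rule mult_mat_index) (use B jk UT_carrier[OF g] in auto)
  also have "\<dots> = (\<Sum>l<n. if l = j then B $$ (j, k) else 0)"
  proof (intro sum.cong refl)
    fix l assume "l \<in> {..<n}"
    then show "g $$ (j, l) * B $$ (l, k) = (if l = j then B $$ (j, k) else 0)"
      using z[of l] UT_index[OF g jk(1), of l] by (cases l j rule: linorder_cases) auto
  qed
  finally show ?thesis using jk by simp
qed

lemma UT_mult_right_index:
  assumes h: "h \<in> UT n" and B: "B \<in> carrier_mat n n" and ij: "i < n" "j < n"
    and z: "\<And>l. l < j \<Longrightarrow> B $$ (i, l) = 0"
  shows "(B * h) $$ (i, j) = B $$ (i, j)"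
proof -
  have "(B * h) $$ (i, j) = (\<Sum>l<n. B $$ (i, l) * h $$ (l, j))"
    by (rule mult_mat_index) (use B ij UT_carrier[OF h] in auto)
  also have "\<dots> = (\<Sum>l<n. if l = j then B $$ (i, j) else 0)"
  proof (intro sum.cong refl)
    fix l assume "l \<in> {..<n}"
    then show "B $$ (i, l) * h $$ (l, j) = (if l = j then B $$ (i, j) else 0)"
      using z[of l] UT_index[OF h, of l j] by (cases l j rule: linorder_cases) auto
  qed
  finally show ?thesis using ij by simp
qed

text \<open>The candidate for the uniqueness lemma is \<open>adj_mat h * row_cofs n A\<close>. In
  its product with the conjugate the inner factors cancel, and left multiplication by a
  unitriangular matrix preserves the zeros below row \<open>k\<close> and the entry in row
  \<open>k\<close>.\<close>

lemma row_minor_conj: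
  assumes h: "h \<in> UT n" and A: "(A :: 'a::field mat) \<in> carrier_mat n n" and jk: "j < n" "k < n"
    and nz: "low_minor n A k \<noteq> 0"
  shows "row_minor n (mat_conj h A) j k = (adj_mat h * (A * row_cofs n A)) $$ (j, k)"
proof -
  define g where "g = adj_mat h"
  have g: "g \<in> UT n" unfolding g_def by (rule adj_mat_in_UT[OF h])
  note [simp] = UT_carrier[OF g] UT_carrier[OF h] adj_mat_UT[OF h, folded g_def] A
  note [simp] = mult_carrier_mat[of _ n n _ n] left_mult_one_mat[of _ n n] assoc_mult_mat[of _ n n _ n _ n]
  have "h * (g * row_cofs n A) = (h * g) * row_cofs n A"
    by (rule assoc_mult_mat[of _ n n _ n _ n, symmetric]) auto
  then have eq: "mat_conj h A * (g * row_cofs n A) = g * (A * row_cofs n A)"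
    by (simp add: mat_conj_def g_def[symmetric])
  have "row_minor n (mat_conj h A) j k = (mat_conj h A * (g * row_cofs n A)) $$ (j, k)"
  proof (rule row_minor_unique)
    show "(g * row_cofs n A) $$ (c, k) = 0" if "c < n" "n \<le> c + k" for c
      using that jk by (subst UT_mult_left_index[OF g]) (auto simp: row_cofs_def)
    show "(mat_conj h A * (g * row_cofs n A)) $$ (l, k) = 0" if "k < l" "l < n" for l
      unfolding eq using that jk
      by (subst UT_mult_left_index[OF g]) (auto simp: mult_row_cofs row_minor_below)
    show "(mat_conj h A * (g * row_cofs n A)) $$ (k, k) = low_minor n (mat_conj h A) k"
      unfolding eq using jk
      by (subst UT_mult_left_index[OF g])
        (auto simp: mult_row_cofs row_minor_below low_minor_conj[OF h A] low_minor_eq_row_minor[of n A])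
    show "low_minor n (mat_conj h A) k \<noteq> 0"
      using nz by (simp add: low_minor_conj[OF h A jk(2)])
  qed (use jk in auto)
  then show ?thesis using eq by (simp only: g_def)
qed

text \<open>Here the candidate is \<open>col_cofs n A * h\<close>; right multiplication by
  \<open>h\<close> preserves the leading zeros of row \<open>i\<close> and the first entry after
  them.\<close>

lemma col_minor_conj:
  assumes h: "h \<in> UT n" and A: "(A :: 'a::field mat) \<in> carrier_mat n n" and ij: "i < n" "j < n"
    and nz: "low_minor n A i \<noteq> 0"
  shows "col_minor n (mat_conj h A) i j = (col_cofs n A * A * h) $$ (i, j)"
proof -
  define g where "g = adj_mat h"
  have g: "g \<in> UT n" unfolding g_def by (rule adj_mat_in_UT[OF h])
  note [simp] = UT_carrier[OF g] UT_carrier[OF h] adj_mat_UT[OF h, folded g_def] A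
  note [simp] = mult_carrier_mat[of _ n n _ n] left_mult_one_mat[of _ n n] assoc_mult_mat[of _ n n _ n _ n]
  have "h * (g * (A * h)) = (h * g) * (A * h)"
    by (rule assoc_mult_mat[of _ n n _ n _ n, symmetric]) auto
  then have eq: "col_cofs n A * h * mat_conj h A = col_cofs n A * A * h"
    by (simp add: mat_conj_def g_def[symmetric])
  have "col_minor n (mat_conj h A) i j = (col_cofs n A * h * mat_conj h A) $$ (i, j)"
  proof (rule col_minor_unique)
    show "(col_cofs n A * h) $$ (i, a) = 0" if "a < i" for a
      using that ij by (subst UT_mult_right_index[OF h]) (auto simp: col_cofs_def)
    show "(col_cofs n A * h * mat_conj h A) $$ (i, l) = 0" if "l < n - 1 - i" for l
      unfolding eq using that ij
      by (subst UT_mult_right_index[OF h]) (auto simp: mult_col_cofs col_minor_left simp del: assoc_mult_mat)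
    show "(col_cofs n A * h * mat_conj h A) $$ (i, n - 1 - i) = low_minor n (mat_conj h A) i"
      unfolding eq using ij
      by (subst UT_mult_right_index[OF h])
        (auto simp: mult_col_cofs col_minor_left low_minor_conj[OF h A] low_minor_eq_col_minor[of n A] simp del: assoc_mult_mat)
    show "low_minor n (mat_conj h A) i \<noteq> 0"
      using nz by (simp add: low_minor_conj[OF h A ij(1)])
  qed (use ij in auto)
  then show ?thesis by (simp only: eq)
qed

text \<open>The row of column minors acquires \<open>h\<close> on the right, the column of row
  minors \<open>adj_mat h\<close> on the left; the two meet and cancel.\<close>

lemma pairing_conj:
  assumes h: "h \<in> UT n" and A: "(A :: 'a::field mat) \<in> carrier_mat n n" and ik: "i < n" "k < n"
    and nz: "low_minor n A i \<noteq> 0" "low_minor n A k \<noteq> 0"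
  shows "pairing n (mat_conj h A) i k = pairing n A i k"
proof -
  define g where "g = adj_mat h"
  have g: "g \<in> UT n" unfolding g_def by (rule adj_mat_in_UT[OF h])
  note [simp] = UT_carrier[OF g] UT_carrier[OF h] adj_mat_UT[OF h, folded g_def] A
  note [simp] = mult_carrier_mat[of _ n n _ n] left_mult_one_mat[of _ n n]
  have "h * (g * (A * row_cofs n A)) = (h * g) * (A * row_cofs n A)"
    by (rule assoc_mult_mat[of _ n n _ n _ n, symmetric]) auto
  then have eq: "(col_cofs n A * A * h) * (g * (A * row_cofs n A)) = (col_cofs n A * A) * (A * row_cofs n A)"
    by (simp add: assoc_mult_mat[of _ n n _ n _ n])
  have "pairing n (mat_conj h A) i k = ((col_cofs n A * A * h) * (g * (A * row_cofs n A))) $$ (i, k)"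
    by (rule pairing_eq_mult)
      (use ik nz in \<open>auto simp: row_minor_conj[OF h A] col_minor_conj[OF h A] g_def[symmetric]\<close>)
  also have "\<dots> = pairing n A i k"
    unfolding eq by (rule pairing_eq_mult[symmetric]) (use ik in \<open>auto simp: mult_row_cofs mult_col_cofs\<close>)
  finally show ?thesis .
qed

section \<open>Matrices vanishing above the antidiagonal\<close>

lemma row_cof_last:
  assumes "k < n"
  shows "row_cof (n - k) 0 (\<lambda>r c. A $$ (k + r, c)) (n - 1 - k) = (-1) ^ (n - 1 - k) * low_minor n A (Suc k)"
proof -
  have "mat_delete (mat (n - k) (n - k) (\<lambda>(r', c). A $$ (k + r', c))) 0 (n - 1 - k)
      = mat (n - Suc k) (n - Suc k) (\<lambda>(r, c). A $$ (Suc k + r, c))"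
    using assms by (intro eq_matI) (auto simp: mat_delete_def)
  then show ?thesis by (simp add: row_cof_def cofactor_def low_minor_def)
qed

text \<open>The slice met by the orbit of the generic matrix.\<close>

definition anti_lower :: "nat \<Rightarrow> 'a::zero mat \<Rightarrow> bool" where
  "anti_lower n Y \<longleftrightarrow> Y \<in> carrier_mat n n \<and> (\<forall>i j. i + j < n - 1 \<longrightarrow> Y $$ (i, j) = 0)"

text \<open>In the first row of the corner block only the last entry, on the antidiagonal, can be
  nonzero. Its cofactor is the next corner minor up to sign.\<close>

lemma low_minor_anti_lower:
  assumes Y: "anti_lower n Y" and k: "k < n"
  shows "low_minor n Y k = (-1) ^ (n - 1 - k) * Y $$ (k, n - 1 - k) * low_minor n Y (Suc k)"
proof -
  have "low_minor n Y k = (\<Sum>c<n - k. Y $$ (k, c) * row_cof (n - k) 0 (\<lambda>r c. Y $$ (k + r, c)) c)"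
    unfolding low_minor_eq_row_minor row_minor_def using k by (intro row_det_laplace) auto
  also have "\<dots> = (\<Sum>c\<in>{n - 1 - k}. Y $$ (k, c) * row_cof (n - k) 0 (\<lambda>r c. Y $$ (k + r, c)) c)"
      proof (rule sum.mono_neutral_right)
    show "\<forall>c\<in>{..<n - k} - {n - 1 - k}. Y $$ (k, c) * row_cof (n - k) 0 (\<lambda>r c. Y $$ (k + r, c)) c = 0"
    proof
      fix c assume "c \<in> {..<n - k} - {n - 1 - k}"
      then have "k + c < n - 1" by auto
      then show "Y $$ (k, c) * row_cof (n - k) 0 (\<lambda>r c. Y $$ (k + r, c)) c = 0"
        using Y by (simp add: anti_lower_def)
    qed
  qed (use k in auto)
  finally show ?thesis using row_cof_last[OF k, of Y] by (simp add: mult_ac)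
qed

lemma row_minor_anti_lower:
  assumes Y: "anti_lower n Y" and jk: "j < k" "k < n"
  shows "row_minor n Y j k = 0"
  unfolding row_minor_def using assms
  by (subst row_det_laplace) (auto simp: anti_lower_def intro!: sum.neutral)

text \<open>On the slice both vectors are explicit: the row of column minors is row \<open>i\<close>
  of \<open>Y\<close> scaled by \<open>low_minor n Y i / Y $$ (i, n - 1 - i)\<close>, and the column
  of row minors is \<open>low_minor n Y k\<close> times a unit vector.\<close>

lemma pairing_anti_lower:
  fixes Y :: "'a::field mat"
  assumes Y: "anti_lower n Y" and ik: "i < n" "k < n"
    and nz: "low_minor n Y i \<noteq> 0"
  shows "pairing n Y i k = low_minor n Y i * low_minor n Y k * Y $$ (i, k) / Y $$ (i, n - 1 - i)"
proof -
  have Yc [simp]: "Y \<in> carrier_mat n n" using Y by (simp add: anti_lower_def)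
  have yi: "Y $$ (i, n - 1 - i) \<noteq> 0" using nz low_minor_anti_lower[OF Y ik(1)] by auto
  define W where "W = mat n n (\<lambda>(a, b). if a = b then low_minor n Y i / Y $$ (i, n - 1 - i) else 0)"
  define C where "C = mat n n (\<lambda>(a, b). if a = b then low_minor n Y a else 0)"
  have WY: "(W * Y) $$ (i, j) = low_minor n Y i / Y $$ (i, n - 1 - i) * Y $$ (i, j)" if "j < n" for j
    using that ik by (subst mult_mat_index[of _ n])
      (auto simp: W_def if_distrib[of "\<lambda>z. z * _"] cong: if_cong)
  have "pairing n Y i k = ((W * Y) * C) $$ (i, k)"
  proof (rule pairing_eq_mult)
    show "col_minor n Y i j = (W * Y) $$ (i, j)" if "j < n" for j
    proof (rule col_minor_unique)
      show "(W * Y) $$ (i, l) = 0" if "l < n - 1 - i" for l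
        using that WY[of l] Y by (simp add: anti_lower_def)
      show "(W * Y) $$ (i, n - 1 - i) = low_minor n Y i"
        using ik yi by (subst WY) auto
    qed (use ik that nz in \<open>auto simp: W_def\<close>)
    show "row_minor n Y j k = C $$ (j, k)" if "j < n" for j
      using that ik row_minor_anti_lower[OF Y, of j k] row_minor_below[of k j n Y]
      by (cases j k rule: linorder_cases) (auto simp: C_def low_minor_eq_row_minor)
  qed (use ik in \<open>auto simp: W_def C_def mult_carrier_mat[of _ n n]\<close>)
  also have "\<dots> = (\<Sum>j<n. (W * Y) $$ (i, j) * C $$ (j, k))"
    using ik by (intro mult_mat_index) (auto simp: W_def C_def mult_carrier_mat[of _ n n])
  also have "\<dots> = (\<Sum>j<n. if j = k then (W * Y) $$ (i, k) * low_minor n Y k else 0)"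
    using ik by (intro sum.cong) (auto simp: C_def)
  also have "\<dots> = (W * Y) $$ (i, k) * low_minor n Y k" using ik by simp
  finally show ?thesis by (simp add: WY[OF ik(2)])
qed

text \<open>Column \<open>k\<close> of \<open>u\<close> is the vector of row minors, normalized by
  its diagonal entry. Thus \<open>A * V = u * \<Delta>\<close>, so that \<open>Y * (g * V)\<close>
  is the diagonal matrix \<open>\<Delta>\<close>, and the triangular shape of \<open>g * V\<close>
  forces the zeros of \<open>Y\<close>.\<close>

lemma exists_conj_anti_lower:
  fixes A :: "'a::field mat"
  assumes A: "A \<in> carrier_mat n n" and nz: "\<And>k. k \<le> n \<Longrightarrow> low_minor n A k \<noteq> 0"
  shows "\<exists>u\<in>UT n. anti_lower n (mat_conj u A)"
proof -
  define u where "u = mat n n (\<lambda>(j, k). row_minor n A j k / low_minor n A k)"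
  have u: "u \<in> UT n"
    by (rule UT_I) (auto simp: u_def row_minor_below nz low_minor_eq_row_minor[symmetric])
  define g where "g = adj_mat u"
  have g: "g \<in> UT n" unfolding g_def by (rule adj_mat_in_UT[OF u])
  define \<Delta> where "\<Delta> = mat n n (\<lambda>(a, b). if a = b then low_minor n A a else 0)"
  define V where "V = row_cofs n A"
  define Y where "Y = mat_conj u A"
  note [simp] = UT_carrier[OF g] UT_carrier[OF u] adj_mat_UT[OF u, folded g_def] A
  note [simp] = mult_carrier_mat[of _ n n _ n] left_mult_one_mat[of _ n n]
  have [simp]: "\<Delta> \<in> carrier_mat n n" "V \<in> carrier_mat n n" "Y \<in> carrier_mat n n"
    by (auto simp: \<Delta>_def V_def Y_def)
  have "A * V = u * \<Delta>"
  proof (rule eq_matI)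
    fix j k assume "j < dim_row (u * \<Delta>)" "k < dim_col (u * \<Delta>)"
    then have jk: "j < n" "k < n" by (auto simp: u_def \<Delta>_def)
    have "(u * \<Delta>) $$ (j, k) = (\<Sum>l<n. u $$ (j, l) * \<Delta> $$ (l, k))"
      using jk by (intro mult_mat_index) auto
    also have "\<dots> = (\<Sum>l<n. if l = k then u $$ (j, k) * low_minor n A k else 0)"
      using jk by (intro sum.cong) (auto simp: \<Delta>_def)
    also have "\<dots> = row_minor n A j k" using jk nz[of k] by (simp add: u_def)
    finally show "(A * V) $$ (j, k) = (u * \<Delta>) $$ (j, k)"
      using jk by (simp add: V_def mult_row_cofs del: index_mult_mat)
  qed (use carrier_matD[OF A] in \<open>auto simp: u_def \<Delta>_def V_def row_cofs_def\<close>)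
  moreover have "g * (u * \<Delta>) = (g * u) * \<Delta>" "u * (g * V) = (u * g) * V"
    by (rule assoc_mult_mat[of _ n n _ n _ n, symmetric]; auto)+
  ultimately have YgV: "Y * (g * V) = \<Delta>"
    by (simp add: Y_def mat_conj_def g_def[symmetric] assoc_mult_mat[of _ n n _ n _ n])
  \<comment> \<open>\<open>V\<close> vanishes beyond the antidiagonal, so multiplication by
    \<open>g\<close> leaves the entries on and beyond it unchanged. The antidiagonal of
    \<open>g * V\<close> still consists of signed corner minors.\<close>
  have gV: "(g * V) $$ (c, k) = V $$ (c, k)" if "c + k \<ge> n - 1" "c < n" "k < n" for c k
    using that by (intro UT_mult_left_index[OF g]) (auto simp: V_def row_cofs_def)
  have "\<forall>i. i + j < n - 1 \<longrightarrow> Y $$ (i, j) = 0" for j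
  proof (induction j rule: less_induct)
    case (less j)
    show ?case
    proof (intro allI impI)
      fix i assume ij: "i + j < n - 1"
      \<comment> \<open>Column \<open>k\<close> of \<open>g * V\<close> ends in row
        \<open>j\<close>, while row \<open>i\<close> of \<open>Y\<close> is already known to vanish
        before column \<open>j\<close>. Hence the zero of \<open>\<Delta>\<close> at
        \<open>(i, k)\<close> leaves a single product, with \<open>c = j\<close>.\<close>
      define k where "k = n - 1 - j"
      have k: "k < n" "k \<noteq> i" "n - 1 - k = j" using ij by (auto simp: k_def)
      have "0 = (Y * (g * V)) $$ (i, k)"
        unfolding YgV using ij k by (auto simp: \<Delta>_def)
      also have "\<dots> = (\<Sum>c<n. Y $$ (i, c) * (g * V) $$ (c, k))"
        using ij k by (intro mult_mat_index) auto
      also have "\<dots> = (\<Sum>c\<in>{j}. Y $$ (i, c) * (g * V) $$ (c, k))"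
      proof (rule sum.mono_neutral_right)
        show "\<forall>c\<in>{..<n} - {j}. Y $$ (i, c) * (g * V) $$ (c, k) = 0"
        proof
          fix c assume c: "c \<in> {..<n} - {j}"
          show "Y $$ (i, c) * (g * V) $$ (c, k) = 0"
          proof (cases "c < j")
            case True
            then show ?thesis using less.IH[OF True] ij by auto
          next
            case False
            then have "(g * V) $$ (c, k) = 0"
              using c ij k by (subst gV) (auto simp: V_def row_cofs_def k_def)
            then show ?thesis by (simp del: index_mult_mat)
          qed
        qed
      qed (use ij in auto)
      also have "(\<Sum>c\<in>{j}. Y $$ (i, c) * (g * V) $$ (c, k)) = Y $$ (i, j) * V $$ (j, k)"
        using ij k by (subst gV[symmetric]) (auto simp: k_def simp del: index_mult_mat)
      also have "V $$ (j, k) = (-1) ^ j * low_minor n A (Suc k)"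
        using ij k row_cof_last[OF k(1), of A] by (simp add: V_def row_cofs_def)
      finally show "Y $$ (i, j) = 0" using nz[of "Suc k"] k by simp
    qed
  qed
  then have "anti_lower n Y" by (auto simp: anti_lower_def)
  with u show ?thesis by (auto simp: Y_def)
qed

text \<open>The two formulas on the slice are solved for the entries: the corner minors fix the
  antidiagonal, the pairings fix the entries below it.\<close>

lemma exists_anti_lower:
  fixes d :: "nat \<Rightarrow> 'a::field"
  assumes d: "\<And>k. k < n \<Longrightarrow> d k \<noteq> 0"
  shows "\<exists>Y. anti_lower n Y \<and> (\<forall>k<n. low_minor n Y k = d k) \<and>
    (\<forall>i k. n - 1 - i < k \<and> i < n \<and> k < n \<longrightarrow> pairing n Y i k = t i k)"
proof -
  \<comment> \<open>The value 1 at index \<open>n\<close> matches the empty minor, so that the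
    recursion also covers \<open>k = n - 1\<close>.\<close>
  define e where "e k = (if k < n then d k else 1)" for k
  \<comment> \<open>The antidiagonal entry dictated by \<open>low_minor_anti_lower\<close>; the sign
    is its own inverse.\<close>
  define z where "z i = (-1) ^ (n - 1 - i) * e i / e (Suc i)" for i
  define Y where "Y = mat n n (\<lambda>(i, k). if i + k < n - 1 then 0 else
     if i + k = n - 1 then z i else t i k * z i / (e i * e k))"
  have e: "e k \<noteq> 0" for k using d by (simp add: e_def)
  have Y: "anti_lower n Y" by (auto simp: anti_lower_def Y_def)
  have low: "k \<le> n \<Longrightarrow> low_minor n Y k = e k" for k
  proof (induction "n - k" arbitrary: k)
    case 0
    then show ?case by (simp add: low_minor_full e_def)
  next
    case (Suc m)
    then have k: "k < n" by simp
    have s: "((-1) ^ (n - 1 - k) :: 'a) * (-1) ^ (n - 1 - k) = 1"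
      by (simp flip: power_mult_distrib)
    have "low_minor n Y k = (-1) ^ (n - 1 - k) * z k * e (Suc k)"
      using Suc k by (subst low_minor_anti_lower[OF Y k]) (auto simp: Y_def)
    also have "\<dots> = ((-1) ^ (n - 1 - k) * (-1) ^ (n - 1 - k)) * e k"
      using e[of "Suc k"] by (simp add: z_def)
    finally show ?case by (simp add: s)
  qed
  have "pairing n Y i k = t i k" if "n - 1 - i < k" "i < n" "k < n" for i k
  proof -
    have "pairing n Y i k = e i * e k * Y $$ (i, k) / Y $$ (i, n - 1 - i)"
      using that e by (subst pairing_anti_lower[OF Y]) (auto simp: low)
    also have "\<dots> = e i * e k * (t i k * z i / (e i * e k)) / z i"
      using that by (auto simp: Y_def)
    finally show ?thesis using e by (simp add: z_def)
  qed
  then show ?thesis using Y low by (intro exI[of _ Y]) (auto simp: e_def)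
qed

section \<open>Evaluation of polynomials and rational functions\<close>

definition monom_eval :: "('v \<Rightarrow> 'b::comm_ring_1) \<Rightarrow> ('v \<Rightarrow>\<^sub>0 nat) \<Rightarrow> 'b" where
  "monom_eval y m = (\<Prod>v\<in>Poly_Mapping.keys m. y v ^ Poly_Mapping.lookup m v)"

lemma monom_eval_superset:
  assumes "finite S" "Poly_Mapping.keys m \<subseteq> S"
  shows "monom_eval y m = (\<Prod>v\<in>S. y v ^ Poly_Mapping.lookup m v)"
  unfolding monom_eval_def
  by (rule prod.mono_neutral_left) (use assms in \<open>auto simp: in_keys_iff\<close>)

lemma monom_eval_0 [simp]: "monom_eval y 0 = 1"
  by (simp add: monom_eval_def)

lemma monom_eval_add: "monom_eval y (a + b) = monom_eval y a * monom_eval y b"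
proof -
  let ?S = "Poly_Mapping.keys a \<union> Poly_Mapping.keys b"
  have "Poly_Mapping.keys (a + b) \<subseteq> ?S" by (rule Poly_Mapping.keys_add)
  then show ?thesis
    by (simp add: monom_eval_superset[of ?S] lookup_add power_add prod.distrib)
qed

lemma monom_eval_single [simp]: "monom_eval y (Poly_Mapping.single v k) = y v ^ k"
  by (cases "k = 0") (auto simp: monom_eval_def)

lemma poly_mapping_eq_sum_single:
  "p = (\<Sum>m\<in>Poly_Mapping.keys p. Poly_Mapping.single m (Poly_Mapping.lookup p m))"
proof (rule poly_mapping_eqI)
  fix k
  have "Poly_Mapping.lookup (\<Sum>m\<in>Poly_Mapping.keys p. Poly_Mapping.single m (Poly_Mapping.lookup p m)) k
     = (\<Sum>m\<in>Poly_Mapping.keys p. if m = k then Poly_Mapping.lookup p k else 0)"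
    by (auto simp: lookup_sum lookup_single when_def intro!: sum.cong)
  also have "\<dots> = Poly_Mapping.lookup p k"
    by (auto simp: sum.delta in_keys_iff)
  finally show "Poly_Mapping.lookup p k = Poly_Mapping.lookup
     (\<Sum>m\<in>Poly_Mapping.keys p. Poly_Mapping.single m (Poly_Mapping.lookup p m)) k" by simp
qed

lemma mpoly_eval_superset:
  assumes "c 0 = 0" "finite S" "Poly_Mapping.keys p \<subseteq> S"
  shows "mpoly_eval c y p = (\<Sum>m\<in>S. c (Poly_Mapping.lookup p m) * monom_eval y m)"
  unfolding mpoly_eval_def monom_eval_def[symmetric]
  by (rule sum.mono_neutral_left) (use assms in \<open>auto simp: in_keys_iff\<close>)

lemma mpoly_eval_single:
  "c 0 = 0 \<Longrightarrow> mpoly_eval c y (Poly_Mapping.single m a) = c a * monom_eval y m"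
  by (subst mpoly_eval_superset[of _ "{m}"]) auto

lemma mpoly_eval_cong:
  assumes "\<And>v. v \<in> mpoly_vars p \<Longrightarrow> y v = y' v"
  shows "mpoly_eval c y p = mpoly_eval c y' p"
proof -
  have "y v = y' v" if "m \<in> Poly_Mapping.keys p" "v \<in> Poly_Mapping.keys m" for m v
    using that by (intro assms) (auto simp: mpoly_vars_def)
  then show ?thesis unfolding mpoly_eval_def by (simp cong: sum.cong prod.cong)
qed

lemma (in comm_ring_hom) mpoly_eval_hom:
  "hom (mpoly_eval c y p) = mpoly_eval (\<lambda>a. hom (c a)) (\<lambda>v. hom (y v)) p"
  by (simp add: mpoly_eval_def hom_distribs)

lemma (in comm_ring_hom) mpoly_eval_add:
  "mpoly_eval hom y (p + q) = mpoly_eval hom y p + mpoly_eval hom y q"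
proof -
  let ?S = "Poly_Mapping.keys p \<union> Poly_Mapping.keys q"
  have "Poly_Mapping.keys (p + q) \<subseteq> ?S" by (rule Poly_Mapping.keys_add)
  then show ?thesis
    by (simp add: mpoly_eval_superset[of hom ?S] lookup_add hom_distribs algebra_simps sum.distrib)
qed

lemma (in comm_ring_hom) mpoly_eval_sum:
  "mpoly_eval hom y (\<Sum>i\<in>I. f i) = (\<Sum>i\<in>I. mpoly_eval hom y (f i))"
proof (induction I rule: infinite_finite_induct)
  case (insert i I)
  then show ?case by (simp add: mpoly_eval_add)
qed (simp_all add: mpoly_eval_def)

lemma (in comm_ring_hom) mpoly_eval_mult:
  "mpoly_eval hom y (p * q) = mpoly_eval hom y p * mpoly_eval hom y q"
proof -
  have "p * q = (\<Sum>a\<in>Poly_Mapping.keys p. \<Sum>b\<in>Poly_Mapping.keys q.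
      Poly_Mapping.single (a + b) (Poly_Mapping.lookup p a * Poly_Mapping.lookup q b))"
    by (subst poly_mapping_eq_sum_single[of p], subst poly_mapping_eq_sum_single[of q])
      (simp add: sum_product mult_single)
  also have "mpoly_eval hom y \<dots> = (\<Sum>a\<in>Poly_Mapping.keys p. \<Sum>b\<in>Poly_Mapping.keys q.
      (hom (Poly_Mapping.lookup p a) * monom_eval y a) * (hom (Poly_Mapping.lookup q b) * monom_eval y b))"
    by (simp add: mpoly_eval_sum mpoly_eval_single monom_eval_add hom_distribs mult_ac)
  also have "\<dots> = mpoly_eval hom y p * mpoly_eval hom y q"
    by (simp add: mpoly_eval_def monom_eval_def[symmetric] sum_product)
  finally show ?thesis .
qed

text \<open>Allows evaluations to be interpreted as homomorphisms, which carry identities between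
  determinants to points.\<close>

lemma (in comm_ring_hom) mpoly_eval_comm_ring_hom:
  "comm_ring_hom (mpoly_eval hom y :: ('v, 'a) mpoly \<Rightarrow> 'b)"
proof
  show "mpoly_eval hom y 1 = 1"
    using mpoly_eval_single[of hom y 0 1] by (simp add: hom_distribs)
qed (simp_all add: mpoly_eval_add mpoly_eval_mult, simp add: mpoly_eval_def)

section \<open>Constants, variables and fractions\<close>

abbreviation mpoly_const :: "'k::comm_ring_1 \<Rightarrow> ('v, 'k) mpoly" where
  "mpoly_const a \<equiv> Poly_Mapping.single 0 a"

definition mpoly_var :: "'v \<Rightarrow> ('v, 'k::comm_ring_1) mpoly" where
  "mpoly_var v = Poly_Mapping.single (Poly_Mapping.single v 1) 1"

lemma mpoly_const_hom: "comm_ring_hom (mpoly_const :: 'k::comm_ring_1 \<Rightarrow> ('v, 'k) mpoly)"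
  by unfold_locales (simp_all add: single_add mult_single)

lemma mpoly_var_power: "mpoly_var v ^ k = (Poly_Mapping.single (Poly_Mapping.single v k) 1 :: ('v, 'k::comm_ring_1) mpoly)"
  by (induction k) (simp_all add: mpoly_var_def mult_single single_add[symmetric])

lemma monom_eval_mpoly_var: "monom_eval mpoly_var m = (Poly_Mapping.single m 1 :: ('v, 'k::comm_ring_1) mpoly)"
proof -
  have "(\<Prod>v\<in>S. mpoly_var v ^ f v) = (Poly_Mapping.single (\<Sum>v\<in>S. Poly_Mapping.single v (f v)) 1 :: ('v, 'k) mpoly)"
    for S and f :: "'v \<Rightarrow> nat"
    by (induction S rule: infinite_finite_induct) (simp_all add: mpoly_var_power mult_single)
  then show ?thesis
    by (simp add: monom_eval_def poly_mapping_eq_sum_single[of m, symmetric])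
qed

lemma mpoly_eval_mpoly_var: "mpoly_eval mpoly_const mpoly_var p = p"
  unfolding mpoly_eval_def monom_eval_def[symmetric]
  by (simp add: monom_eval_mpoly_var mult_single poly_mapping_eq_sum_single[of p, symmetric])

lemma mpoly_eval_map:
  assumes "\<sigma> 0 = 0" "c 0 = 0"
  shows "mpoly_eval c y (Poly_Mapping.map \<sigma> p) = mpoly_eval (\<lambda>a. c (\<sigma> a)) y p"
proof -
  have "Poly_Mapping.keys (Poly_Mapping.map \<sigma> p) \<subseteq> Poly_Mapping.keys p"
    by (auto simp: in_keys_iff Poly_Mapping.map.rep_eq when_def)
  then show ?thesis
    using assms
    by (subst (1 2) mpoly_eval_superset[of _ "Poly_Mapping.keys p"])
      (auto simp: Poly_Mapping.map.rep_eq when_def intro!: sum.cong)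
qed

lemma mpoly_vars_map: "mpoly_vars (Poly_Mapping.map \<sigma> p) \<subseteq> mpoly_vars p"
  by (auto simp: mpoly_vars_def in_keys_iff Poly_Mapping.map.rep_eq when_def split: if_splits)

lemma mpoly_vars_add: "mpoly_vars (p + q) \<subseteq> mpoly_vars p \<union> mpoly_vars q"
  unfolding mpoly_vars_def using Poly_Mapping.keys_add[of p q] by fastforce

lemma mpoly_vars_uminus: "mpoly_vars (- p) = mpoly_vars (p :: ('v, 'k::ab_group_add) mpoly)"
  by (auto simp: mpoly_vars_def in_keys_iff)

lemma mpoly_vars_mult: "mpoly_vars (p * q) \<subseteq> mpoly_vars p \<union> mpoly_vars q"
proof
  fix v assume "v \<in> mpoly_vars (p * q)"
  then obtain m where m: "m \<in> Poly_Mapping.keys (p * q)" "v \<in> Poly_Mapping.keys m"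
    by (auto simp: mpoly_vars_def)
  then obtain a b where ab: "m = a + b" "a \<in> Poly_Mapping.keys p" "b \<in> Poly_Mapping.keys q"
    using keys_mult[of p q] by blast
  then show "v \<in> mpoly_vars p \<union> mpoly_vars q"
    using m(2) Poly_Mapping.keys_add[of a b] by (auto simp: mpoly_vars_def)
qed

lemma mpoly_vars_const [simp]: "mpoly_vars (mpoly_const a) = {}"
  by (auto simp: mpoly_vars_def)

lemma mpoly_vars_one [simp]: "mpoly_vars (1 :: ('v, 'k::comm_ring_1) mpoly) = {}"
  by (auto simp: mpoly_vars_def)

lemma mpoly_vars_var: "mpoly_vars (mpoly_var v) \<subseteq> {v}"
  by (auto simp: mpoly_vars_def mpoly_var_def split: if_splits)

lemma to_fract_hom: "inj_comm_ring_hom to_fract"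
  by unfold_locales (simp_all add: to_fract_def eq_fract Zero_fract_def One_fract_def)

lemma const_eq: "const a = to_fract (mpoly_const a)"
  by (simp add: const_def to_fract_def)

lemma coord_eq: "coord v = to_fract (mpoly_var v)"
  by (simp add: coord_def mpoly_var_def to_fract_def)

lemma const_hom: "inj_comm_ring_hom (const :: 'k::field \<Rightarrow> 'k ratfun)"
proof -
  interpret f: inj_comm_ring_hom "to_fract :: (nat \<times> nat, 'k) mpoly \<Rightarrow> 'k ratfun" by (rule to_fract_hom)
  interpret c: comm_ring_hom "mpoly_const :: 'k \<Rightarrow> (nat \<times> nat, 'k) mpoly" by (rule mpoly_const_hom)
  show ?thesis
  proof
    show "x = 0" if "const x = 0" for x :: 'k
      using that lookup_single_eq[of "0 :: (nat \<times> nat) \<Rightarrow>\<^sub>0 nat" x] by (simp add: const_eq del: lookup_single_eq)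
  qed (simp_all add: const_eq c.hom_add c.hom_mult f.hom_add f.hom_mult)
qed

lemma mpoly_eval_to_fract:
  "mpoly_eval const (\<lambda>v. to_fract (y v)) p = to_fract (mpoly_eval mpoly_const y p)"
proof -
  interpret f: inj_comm_ring_hom "to_fract :: (nat \<times> nat, 'k::field) mpoly \<Rightarrow> 'k ratfun" by (rule to_fract_hom)
  show ?thesis by (simp add: f.mpoly_eval_hom const_eq[abs_def])
qed

lemma mpoly_eval_coord: "mpoly_eval const coord p = to_fract p"
  by (simp add: coord_eq[abs_def] mpoly_eval_to_fract mpoly_eval_mpoly_var)

text \<open>Uniqueness for the definite description: two representations satisfy
  \<open>p * q' = p' * q\<close>, and evaluation carries this equation to the values.\<close>

lemma ratfun_eval_Fract:
  fixes c :: "'k::field \<Rightarrow> 'b::field"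
  assumes "comm_ring_hom c" and nz: "mpoly_eval c y q \<noteq> 0"
  shows "ratfun_eval c y (Fract p q) = mpoly_eval c y p / mpoly_eval c y q"
  unfolding ratfun_eval_def
proof (rule the_equality)
  interpret c: comm_ring_hom c by fact
  interpret e: comm_ring_hom "mpoly_eval c y :: (nat \<times> nat, 'k) mpoly \<Rightarrow> 'b"
    by (rule c.mpoly_eval_comm_ring_hom)
  show "\<exists>p' q'. Fract p q = Fract p' q' \<and> mpoly_eval c y q' \<noteq> 0 \<and>
      mpoly_eval c y p / mpoly_eval c y q = mpoly_eval c y p' / mpoly_eval c y q'"
    using nz by blast
  fix z assume "\<exists>p' q'. Fract p q = Fract p' q' \<and> mpoly_eval c y q' \<noteq> 0 \<and>
      z = mpoly_eval c y p' / mpoly_eval c y q'"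
  then obtain p' q' where *: "Fract p q = Fract p' q'" "mpoly_eval c y q' \<noteq> 0"
      "z = mpoly_eval c y p' / mpoly_eval c y q'" by blast
  have "q \<noteq> 0" "q' \<noteq> 0" using nz *(2) by auto
  then have "p * q' = p' * q" using *(1) by (simp add: eq_fract)
  then have "mpoly_eval c y (p * q') = mpoly_eval c y (p' * q)" by simp
  then show "z = mpoly_eval c y p / mpoly_eval c y q"
    using nz *(2,3) by (simp add: e.hom_mult frac_eq_eq)
qed

section \<open>Subfields\<close>

text \<open>Since \<open>inverse 0 = 0\<close>, closure under \<open>inverse\<close> carries no side
  condition.\<close>

definition subfield_set :: "'a::field set \<Rightarrow> bool" where
  "subfield_set S \<longleftrightarrow> 1 \<in> S \<and> (\<forall>x\<in>S. - x \<in> S \<and> inverse x \<in> S) \<and> (\<forall>x\<in>S. \<forall>y\<in>S. x + y \<in> S \<and> x * y \<in> S)"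

context
  fixes S :: "'a::field set"
  assumes S: "subfield_set S"
begin

lemma subfield_set_one: "1 \<in> S"
  and subfield_set_uminus: "x \<in> S \<Longrightarrow> - x \<in> S"
  and subfield_set_inverse: "x \<in> S \<Longrightarrow> inverse x \<in> S"
  and subfield_set_add: "x \<in> S \<Longrightarrow> y \<in> S \<Longrightarrow> x + y \<in> S"
  and subfield_set_mult: "x \<in> S \<Longrightarrow> y \<in> S \<Longrightarrow> x * y \<in> S"
  using S by (auto simp: subfield_set_def)

lemma subfield_set_zero: "0 \<in> S"
  using subfield_set_add[OF subfield_set_one subfield_set_uminus[OF subfield_set_one]] by simp

lemma subfield_set_divide: "x \<in> S \<Longrightarrow> y \<in> S \<Longrightarrow> x / y \<in> S"
  by (simp add: field_class.field_divide_inverse subfield_set_inverse subfield_set_mult)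

lemma subfield_set_sum: "(\<And>i. i \<in> I \<Longrightarrow> f i \<in> S) \<Longrightarrow> sum f I \<in> S"
  by (induction I rule: infinite_finite_induct) (auto simp: subfield_set_zero subfield_set_add)

lemma subfield_set_prod: "(\<And>i. i \<in> I \<Longrightarrow> f i \<in> S) \<Longrightarrow> prod f I \<in> S"
  by (induction I rule: infinite_finite_induct) (auto simp: subfield_set_one subfield_set_mult)

lemma subfield_set_power: "x \<in> S \<Longrightarrow> x ^ k \<in> S"
  by (induction k) (auto simp: subfield_set_one subfield_set_mult)

lemma subfield_set_det:
  assumes "\<And>i j. i < m \<Longrightarrow> j < m \<Longrightarrow> f (i, j) \<in> S"
  shows "det (mat m m f) \<in> S"
proof -
  have "signof p \<in> S" for p :: "nat \<Rightarrow> nat"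
    by (simp add: sign_def subfield_set_one subfield_set_uminus)
  moreover have "(mat m m f) $$ (i, p i) \<in> S" if "p permutes {0..<m}" "i < m" for p i
    using that assms permutes_in_image[OF that(1), of i] by auto
  ultimately show ?thesis
    unfolding Determinant.det_def by (auto intro!: subfield_set_sum subfield_set_mult subfield_set_prod)
qed

lemma subfield_set_mpoly_eval:
  assumes "\<And>a. c a \<in> S" "\<And>v. v \<in> mpoly_vars p \<Longrightarrow> y v \<in> S"
  shows "mpoly_eval c y p \<in> S"
  unfolding mpoly_eval_def using assms
  by (intro subfield_set_sum subfield_set_mult subfield_set_prod subfield_set_power) (auto simp: mpoly_vars_def)

lemma subfield_set_mult_mat:
  assumes "A \<in> carrier_mat n n" "B \<in> carrier_mat n n" "\<And>i j. i < n \<Longrightarrow> j < n \<Longrightarrow> A $$ (i, j) \<in> S"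
    "\<And>i j. i < n \<Longrightarrow> j < n \<Longrightarrow> B $$ (i, j) \<in> S" "i < n" "j < n"
  shows "(A * B) $$ (i, j) \<in> S"
  using assms by (subst mult_mat_index[of _ n]) (auto intro!: subfield_set_sum subfield_set_mult)

lemma subfield_set_adj_mat:
  assumes h: "h \<in> carrier_mat n n" and hS: "\<And>i j. i < n \<Longrightarrow> j < n \<Longrightarrow> h $$ (i, j) \<in> S" and ij: "i < n" "j < n"
  shows "adj_mat h $$ (i, j) \<in> S"
proof -
  have "(-1) ^ (j + i) \<in> S" by (intro subfield_set_power subfield_set_uminus subfield_set_one)
  moreover have "det (mat_delete h j i) \<in> S"
    unfolding mat_delete_def using h ij by (auto intro!: subfield_set_det hS)
  ultimately show ?thesis
    using h ij by (simp add: adj_mat_def cofactor_def subfield_set_mult)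
qed

lemma subfield_set_mat_conj:
  assumes "h \<in> carrier_mat n n" "A \<in> carrier_mat n n" "\<And>i j. i < n \<Longrightarrow> j < n \<Longrightarrow> h $$ (i, j) \<in> S"
    "\<And>i j. i < n \<Longrightarrow> j < n \<Longrightarrow> A $$ (i, j) \<in> S" "i < n" "j < n"
  shows "mat_conj h A $$ (i, j) \<in> S"
proof -
  have "adj_mat h \<in> carrier_mat n n" "adj_mat h * A \<in> carrier_mat n n"
    using assms adj_mat(1)[OF assms(1)] by (auto intro: mult_carrier_mat)
  then show ?thesis
    unfolding mat_conj_def using assms
    by (intro subfield_set_mult_mat) (auto intro!: subfield_set_mult_mat subfield_set_adj_mat)
qed

end

section \<open>Generated fields\<close>

lemma ring_of_type_algebra_simps:
  "\<one>\<^bsub>ring_of_type_algebra\<^esub> = 1" "\<zero>\<^bsub>ring_of_type_algebra\<^esub> = 0"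
  "x \<oplus>\<^bsub>ring_of_type_algebra\<^esub> y = x + y" "x \<otimes>\<^bsub>ring_of_type_algebra\<^esub> y = x * y"
  "carrier ring_of_type_algebra = UNIV"
  by (simp_all add: ring_of_type_algebra_def)

lemma a_inv_type_algebra: "\<ominus>\<^bsub>ring_of_type_algebra\<^esub> x = - (x :: 'a::field)"
proof -
  interpret R: field "ring_of_type_algebra :: 'a ring" by (rule field_from_type_algebra)
  show ?thesis
    by (rule R.minus_equality) (simp_all add: ring_of_type_algebra_simps)
qed

lemma m_inv_type_algebra: "x \<noteq> 0 \<Longrightarrow> inv\<^bsub>ring_of_type_algebra\<^esub> x = inverse (x :: 'a::field)"
proof -
  interpret R: field "ring_of_type_algebra :: 'a ring" by (rule field_from_type_algebra)
  assume "x \<noteq> 0"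
  then show ?thesis
    by (intro R.comm_inv_char) (simp_all add: ring_of_type_algebra_simps)
qed

lemma subfield_set_adjoin: "subfield_set (adjoin H)"
proof -
  let ?R = "ring_of_type_algebra :: 'a ratfun ring"
  let ?G = "generate_field ?R (range const \<union> H)"
  have one: "1 \<in> ?G" using generate_field.one[of ?R] by (simp add: ring_of_type_algebra_simps)
  have um: "- x \<in> ?G" if "x \<in> ?G" for x
    using generate_field.a_inv[OF that] by (simp add: a_inv_type_algebra)
  have add: "x + y \<in> ?G" if "x \<in> ?G" "y \<in> ?G" for x y
    using generate_field.eng_add[OF that] by (simp add: ring_of_type_algebra_simps)
  have mult: "x * y \<in> ?G" if "x \<in> ?G" "y \<in> ?G" for x y
    using generate_field.eng_mult[OF that] by (simp add: ring_of_type_algebra_simps)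
  have minv: "inverse x \<in> ?G" if "x \<in> ?G" for x
  proof (cases "x = 0")
    case False
    then show ?thesis
      using generate_field.m_inv[OF that] by (simp add: ring_of_type_algebra_simps m_inv_type_algebra)
  qed (use that in simp)
  show ?thesis by (simp add: subfield_set_def adjoin_def one um add mult minv)
qed

lemma const_in_adjoin: "const a \<in> adjoin H"
  by (auto simp: adjoin_def intro: generate_field.incl)

lemma in_adjoin: "x \<in> H \<Longrightarrow> x \<in> adjoin H"
  by (auto simp: adjoin_def intro: generate_field.incl)

lemma adjoin_least:
  assumes S: "subfield_set S" and "range const \<subseteq> S" "H \<subseteq> S"
  shows "adjoin H \<subseteq> S"
proof
  fix x assume "x \<in> adjoin H"
  then show "x \<in> S" unfolding adjoin_def
  proof (induction rule: generate_field.induct)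
    case (m_inv h)
    then show ?case using S by (simp add: ring_of_type_algebra_simps m_inv_type_algebra subfield_set_inverse)
  qed (use assms in \<open>auto simp: ring_of_type_algebra_simps a_inv_type_algebra subfield_set_one
      subfield_set_uminus subfield_set_add subfield_set_mult\<close>)
qed

text \<open>The fractions with numerator and denominator in the variables \<open>V\<close> form a
  subfield containing the constants and the coordinates.\<close>

lemma adjoin_coord_Fract:
  assumes "f \<in> adjoin (coord ` V)"
  shows "\<exists>p q. f = Fract p q \<and> q \<noteq> 0 \<and> mpoly_vars p \<subseteq> V \<and> mpoly_vars q \<subseteq> V"
proof -
  let ?S = "{Fract p q |p q. q \<noteq> 0 \<and> mpoly_vars p \<subseteq> V \<and> mpoly_vars q \<subseteq> V} :: 'a ratfun set"
  have I: "x = Fract p q \<Longrightarrow> q \<noteq> 0 \<Longrightarrow> mpoly_vars p \<subseteq> V \<Longrightarrow> mpoly_vars q \<subseteq> V \<Longrightarrow> x \<in> ?S"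
    for x p q by blast
  have "subfield_set ?S"
    unfolding subfield_set_def
  proof (intro conjI ballI)
    show "1 \<in> ?S" by (intro I[of _ 1 1]) (auto simp: One_fract_def)
  next
    fix x :: "'a ratfun" assume "x \<in> ?S"
    then obtain p q where x: "x = Fract p q" "q \<noteq> 0" "mpoly_vars p \<subseteq> V" "mpoly_vars q \<subseteq> V" by auto
    show "- x \<in> ?S"
      using x by (intro I[of _ "- p" q]) (auto simp: mpoly_vars_uminus)
    show "inverse x \<in> ?S"
    proof (cases "p = 0")
      case True
      then show ?thesis using x
        by (intro I[of _ 0 1]) (auto simp: eq_fract mpoly_vars_def)
    next
      case False
      then show ?thesis using x by (intro I[of _ q p]) auto
    qed
  next
    fix x y :: "'a ratfun" assume "x \<in> ?S" "y \<in> ?S"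
    then obtain p q r s where x: "x = Fract p q" "q \<noteq> 0" "mpoly_vars p \<subseteq> V" "mpoly_vars q \<subseteq> V"
      and y: "y = Fract r s" "s \<noteq> 0" "mpoly_vars r \<subseteq> V" "mpoly_vars s \<subseteq> V" by auto
    have "mpoly_vars (p * s + r * q) \<subseteq> V"
      using x y mpoly_vars_mult[of p s] mpoly_vars_mult[of r q] mpoly_vars_add[of "p * s" "r * q"]
      by blast
    then show "x + y \<in> ?S"
      using x y mpoly_vars_mult[of q s]
      by (intro I[of _ "p * s + r * q" "q * s"]) auto
    show "x * y \<in> ?S"
      using x y mpoly_vars_mult[of p r] mpoly_vars_mult[of q s]
      by (intro I[of _ "p * r" "q * s"]) auto
  qed
  moreover have "range const \<subseteq> ?S"
  proof
    fix x :: "'a ratfun" assume "x \<in> range const"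
    then obtain a where "x = Fract (mpoly_const a) 1" by (auto simp: const_def)
    then show "x \<in> ?S" by (intro I[of _ "mpoly_const a" 1]) auto
  qed
  moreover have "coord ` V \<subseteq> ?S"
  proof
    fix x :: "'a ratfun" assume "x \<in> coord ` V"
    then obtain v where "x = Fract (mpoly_var v) 1" "v \<in> V" by (auto simp: coord_def mpoly_var_def)
    then show "x \<in> ?S" using mpoly_vars_var[of v, where ?'b = 'a]
      by (intro I[of _ "mpoly_var v" 1]) auto
  qed
  ultimately have "adjoin (coord ` V) \<subseteq> ?S" by (rule adjoin_least)
  then show ?thesis using assms by auto
qed

text \<open>Over a finite field, 1 plus the product of all \<open>X - a\<close> has positive degree
  but takes the value 1 everywhere.\<close>

lemma infinite_UNIV_alg_closed: "infinite (UNIV :: 'a::alg_closed_field set)"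
proof
  assume fin: "finite (UNIV :: 'a set)"
  define p :: "'a poly" where "p = (\<Prod>a\<in>UNIV. [:- a, 1:]) + 1"
  have "Polynomial.degree (\<Prod>a\<in>(UNIV :: 'a set). [:- a, 1:]) = card (UNIV :: 'a set)"
    by (subst degree_prod_eq_sum_degree) (use fin in auto)
  moreover have "card (UNIV :: 'a set) > 0" using fin by (simp add: card_gt_0_iff)
  ultimately have "Polynomial.degree p > 0" by (simp add: p_def degree_add_eq_left)
  then obtain x where "poly p x = 0" using alg_closed_imp_poly_has_root by blast
  moreover have "poly (\<Prod>a\<in>UNIV. [:- a, 1:]) x = 0"
    using fin by (auto simp: poly_prod)
  ultimately show False by (simp add: p_def)
qed

section \<open>Density and the generic matrix\<close>

text \<open>
  Polynomial dependence on each parameter separately suffices for the density argument and avoids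
  a generic unitriangular matrix over a second polynomial ring.
\<close>

definition sep_poly :: "(('v \<Rightarrow> 'b::field) \<Rightarrow> 'b) \<Rightarrow> bool" where
  "sep_poly F \<longleftrightarrow> (\<forall>v y. \<exists>r. \<forall>s. F (y(v := s)) = poly r s)"

lemma sep_poly_const [intro]: "sep_poly (\<lambda>_. a)"
  unfolding sep_poly_def by (intro allI exI[of _ "[:a:]"]) simp

lemma sep_poly_var [intro]: "sep_poly (\<lambda>y. y v)"
  unfolding sep_poly_def
proof (intro allI)
  fix w and y :: "'a \<Rightarrow> 'b"
  show "\<exists>r. \<forall>s. (y(w := s)) v = poly r s"
    by (cases "w = v") (auto intro: exI[of _ "[:0, 1:]"] exI[of _ "[:y v:]"])
qed

lemma sep_poly_add [intro]:
  assumes "sep_poly F" "sep_poly G"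
  shows "sep_poly (\<lambda>y. F y + G y)"
  unfolding sep_poly_def
proof (intro allI)
  fix v and y :: "'a \<Rightarrow> 'b"
  obtain r r' where "\<forall>s. F (y(v := s)) = poly r s" "\<forall>s. G (y(v := s)) = poly r' s"
    using assms unfolding sep_poly_def by meson
  then show "\<exists>r. \<forall>s. F (y(v := s)) + G (y(v := s)) = poly r s"
    by (intro exI[of _ "r + r'"]) simp
qed

lemma sep_poly_mult [intro]:
  assumes "sep_poly F" "sep_poly G"
  shows "sep_poly (\<lambda>y. F y * G y)"
  unfolding sep_poly_def
proof (intro allI)
  fix v and y :: "'a \<Rightarrow> 'b"
  obtain r r' where "\<forall>s. F (y(v := s)) = poly r s" "\<forall>s. G (y(v := s)) = poly r' s"
    using assms unfolding sep_poly_def by meson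
  then show "\<exists>r. \<forall>s. F (y(v := s)) * G (y(v := s)) = poly r s"
    by (intro exI[of _ "r * r'"]) simp
qed

lemma sep_poly_diff:
  assumes "sep_poly F" "sep_poly G"
  shows "sep_poly (\<lambda>y. F y - G y)"
  using sep_poly_add[OF assms(1) sep_poly_mult[OF sep_poly_const[of "-1"] assms(2)]] by simp

lemma sep_poly_sum:
  "(\<And>i. i \<in> I \<Longrightarrow> sep_poly (F i)) \<Longrightarrow> sep_poly (\<lambda>y. \<Sum>i\<in>I. F i y)"
  by (induction I rule: infinite_finite_induct) auto

lemma sep_poly_prod:
  "(\<And>i. i \<in> I \<Longrightarrow> sep_poly (F i)) \<Longrightarrow> sep_poly (\<lambda>y. \<Prod>i\<in>I. F i y)"
  by (induction I rule: infinite_finite_induct) auto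

lemma sep_poly_power: "sep_poly F \<Longrightarrow> sep_poly (\<lambda>y. F y ^ k)"
  by (induction k) auto

lemma sep_poly_det:
  assumes "\<And>i j. i < m \<Longrightarrow> j < m \<Longrightarrow> sep_poly (\<lambda>y. f y (i, j))"
  shows "sep_poly (\<lambda>y. det (mat m m (f y)))"
proof -
  have "det (mat m m (f y)) = (\<Sum>p\<in>{p. p permutes {0..<m}}. signof p * (\<Prod>i = 0..<m. f y (i, p i)))" for y
    by (subst det_def'[of _ m]) (auto intro!: sum.cong prod.cong)
  then show ?thesis
    using assms by (auto intro!: sep_poly_sum sep_poly_prod sep_poly_mult)
qed

lemma sep_poly_mpoly_eval:
  assumes "\<And>v. v \<in> mpoly_vars p \<Longrightarrow> sep_poly (\<lambda>t. y t v)"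
  shows "sep_poly (\<lambda>t. mpoly_eval c (y t) p)"
  unfolding mpoly_eval_def using assms
  by (intro sep_poly_sum sep_poly_mult sep_poly_prod sep_poly_power sep_poly_const) (auto simp: mpoly_vars_def)

text \<open>The variables are released from \<open>A\<close> one at a time: as a polynomial in one
  variable, \<open>F\<close> has all elements of the infinite set \<open>A\<close> as roots.\<close>

lemma sep_poly_zero:
  fixes F :: "('v \<Rightarrow> 'b::field) \<Rightarrow> 'b"
  assumes F: "sep_poly F" and A: "infinite A" and V: "finite V"
    and zero: "\<And>y. (\<And>v. v \<in> V \<Longrightarrow> y v \<in> A) \<Longrightarrow> (\<And>v. v \<notin> V \<Longrightarrow> y v = 0) \<Longrightarrow> F y = 0"
    and y: "\<And>v. v \<notin> V \<Longrightarrow> y v = 0"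
  shows "F y = 0"
proof -
  \<comment> \<open>\<open>W\<close> collects the variables already released; the claim is the case
    \<open>W = V\<close>.\<close>
  have "\<forall>y. (\<forall>v\<in>V - W. y v \<in> A) \<and> (\<forall>v. v \<notin> V \<longrightarrow> y v = 0) \<longrightarrow> F y = 0" if "finite W" "W \<subseteq> V" for W
    using that
  proof (induction W rule: finite_induct)
    case empty
    then show ?case using zero by auto
  next
    case (insert w W)
    show ?case
    proof (intro allI impI)
      fix y assume y: "(\<forall>v\<in>V - insert w W. y v \<in> A) \<and> (\<forall>v. v \<notin> V \<longrightarrow> y v = 0)"
      obtain r where r: "\<forall>s. F (y(w := s)) = poly r s" using F unfolding sep_poly_def by meson
      have "poly r s = 0" if "s \<in> A" for s
        using insert.IH insert.prems y that unfolding r[rule_format, symmetric] by auto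
      then have "A \<subseteq> {s. poly r s = 0}" by auto
      then have "r = 0" using A poly_roots_finite[of r] finite_subset by blast
      then show "F y = 0" using r[rule_format, of "y w"] by simp
    qed
  qed
  from this[OF V] y show ?thesis by auto
qed

definition unitri :: "nat \<Rightarrow> (nat \<times> nat \<Rightarrow> 'b::field) \<Rightarrow> 'b mat" where
  "unitri n t = mat n n (\<lambda>(a, b). if a = b then 1 else if a < b then t (a, b) else 0)"

lemma unitri_UT: "unitri n t \<in> UT n"
  by (rule UT_I) (auto simp: unitri_def)

text \<open>The parameters are 0 off the strict upper triangle to meet the support condition of
  \<open>sep_poly_zero\<close>.\<close>

lemma UT_eq_unitri:
  "h \<in> UT n \<Longrightarrow> h = unitri n (\<lambda>(a, b). if a < b \<and> b < n then h $$ (a, b) else 0)"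
  using UT_carrier[of h n] by (intro eq_matI) (auto simp: unitri_def UT_index)

text \<open>Zariski density of the unitriangular matrices whose entries above the diagonal lie in an
  infinite set.\<close>

lemma UT_density:
  fixes F :: "'b::field mat \<Rightarrow> 'b"
  assumes F: "sep_poly (\<lambda>t. F (unitri n t))" and A: "infinite A"
    and zero: "\<And>h. h \<in> UT n \<Longrightarrow> (\<And>a b. a < b \<Longrightarrow> b < n \<Longrightarrow> h $$ (a, b) \<in> A) \<Longrightarrow> F h = 0"
    and h: "h \<in> UT n"
  shows "F h = 0"
proof -
  let ?V = "{(a, b). a < b \<and> b < n}"
  have "?V \<subseteq> {..<n} \<times> {..<n}" by auto
  then have V: "finite ?V" by (rule finite_subset) auto
  have "F (unitri n (\<lambda>(a, b). if a < b \<and> b < n then h $$ (a, b) else 0)) = 0"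
  proof (rule sep_poly_zero[OF F A V])
    fix y assume "\<And>v. v \<in> ?V \<Longrightarrow> y v \<in> A"
    then show "F (unitri n y) = 0"
      by (intro zero unitri_UT) (auto simp: unitri_def)
  qed (auto split: if_splits)
  then show ?thesis by (simp only: UT_eq_unitri[OF h, symmetric])
qed

lemma sep_poly_mat_conj:
  assumes B: "B \<in> carrier_mat n n" and ij: "i < n" "j < n"
  shows "sep_poly (\<lambda>t. mat_conj (unitri n t) B $$ (i, j))"
proof -
  have U: "sep_poly (\<lambda>t. unitri n t $$ (a, b) :: 'a)" if "a < n" "b < n" for a b
    using that by (cases a b rule: linorder_cases) (auto simp: unitri_def)
  have uc: "unitri n t \<in> carrier_mat n n" for t by (simp add: unitri_def)
  have ac: "adj_mat (unitri n t) \<in> carrier_mat n n" for t by (rule adj_mat(1)[OF uc])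
  have adj: "sep_poly (\<lambda>t. adj_mat (unitri n t) $$ (a, b) :: 'a)" if "a < n" "b < n" for a b
  proof -
    have "adj_mat (unitri n t) $$ (a, b) = (-1) ^ (b + a) * det (mat (n - 1) (n - 1) (\<lambda>(i, j).
        unitri n t $$ (if i < b then i else Suc i, if j < a then j else Suc j)))" for t :: "nat \<times> nat \<Rightarrow> 'a"
      using that uc[of t] by (simp add: adj_mat_def cofactor_def mat_delete_def)
    then show ?thesis
      by (auto intro!: sep_poly_mult sep_poly_det U)
  qed
  have "mat_conj (unitri n t) B $$ (i, j)
      = (\<Sum>l<n. (\<Sum>m<n. adj_mat (unitri n t) $$ (i, m) * B $$ (m, l)) * unitri n t $$ (l, j))" for t
    unfolding mat_conj_def
    using mult_mat_index[OF mult_carrier_mat[OF ac B] uc ij, of t t] mult_mat_index[OF ac B ij(1), of _ t] by simp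
  then show ?thesis
    using ij by (auto intro!: sep_poly_sum sep_poly_mult adj U)
qed

text \<open>The point at which \<open>rho\<close> evaluates. It is meaningful for indices from
  \<open>{1..n}\<close>, which explains the recurring condition on
  \<open>mpoly_vars\<close>.\<close>

definition mat_point :: "'b mat \<Rightarrow> nat \<times> nat \<Rightarrow> 'b" where
  "mat_point Y = (\<lambda>(i, j). Y $$ (i - 1, j - 1))"

lemma sep_poly_eval_conj:
  assumes "B \<in> carrier_mat n n" "mpoly_vars p \<subseteq> {1..n} \<times> {1..n}"
  shows "sep_poly (\<lambda>t. mpoly_eval c (mat_point (mat_conj (unitri n t) B)) p)"
proof (rule sep_poly_mpoly_eval)
  fix v assume "v \<in> mpoly_vars p"
  with assms obtain i j where "v = (i, j)" "i \<in> {1..n}" "j \<in> {1..n}" by blast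
  then show "sep_poly (\<lambda>t. mat_point (mat_conj (unitri n t) B) v)"
    using sep_poly_mat_conj[OF assms(1), of "i - 1" "j - 1"] by (auto simp: mat_point_def)
qed

text \<open>Equality of quotients is used in cross-multiplied form, which is polynomial in the
  entries of \<open>h\<close>; \<open>r\<close> and \<open>s\<close> do not depend on
  \<open>h\<close>.\<close>

lemma eval_conj_identity_density:
  fixes B :: "'b::field mat"
  assumes B: "B \<in> carrier_mat n n" and p: "mpoly_vars p \<subseteq> {1..n} \<times> {1..n}"
    and q: "mpoly_vars q \<subseteq> {1..n} \<times> {1..n}" and A: "infinite A"
    and eq: "\<And>h. h \<in> UT n \<Longrightarrow> (\<And>a b. a < b \<Longrightarrow> b < n \<Longrightarrow> h $$ (a, b) \<in> A) \<Longrightarrow>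
      mpoly_eval c (mat_point (mat_conj h B)) p * s = r * mpoly_eval c (mat_point (mat_conj h B)) q"
    and h: "h \<in> UT n"
  shows "mpoly_eval c (mat_point (mat_conj h B)) p * s = r * mpoly_eval c (mat_point (mat_conj h B)) q"
proof -
  have "mpoly_eval c (mat_point (mat_conj h B)) p * s - r * mpoly_eval c (mat_point (mat_conj h B)) q = 0"
    by (rule UT_density[OF _ A _ h])
      (use eq in \<open>auto intro!: sep_poly_diff sep_poly_mult sep_poly_eval_conj B p q\<close>)
  then show ?thesis by simp
qed

section \<open>The generic matrix and ring homomorphisms\<close>

lemma row_det_cong:
  assumes "\<And>r' c. r' < m \<Longrightarrow> c < m \<Longrightarrow> b r' c = b' r' c" "\<And>c. c < m \<Longrightarrow> y c = y' c"
  shows "row_det m r b y = row_det m r b' y'"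
  unfolding row_det_def
  by (rule arg_cong[of _ _ det]) (use assms in \<open>auto intro!: eq_matI\<close>)

text \<open>The generic matrix before passing to fractions. Its minors are polynomials, so
  evaluation homomorphisms apply to them, and \<open>to_fract\<close> maps them to those of
  \<open>generic_mat\<close>.\<close>

definition poly_mat :: "nat \<Rightarrow> (nat \<times> nat, 'k::comm_ring_1) mpoly mat" where
  "poly_mat n = mat n n (\<lambda>(a, b). mpoly_var (Suc a, Suc b))"

lemma poly_mat_carrier [simp]: "poly_mat n \<in> carrier_mat n n"
  by (simp add: poly_mat_def)

lemma generic_mat_carrier [simp]: "generic_mat n \<in> carrier_mat n n"
  by (simp add: generic_mat_def)

lemma generic_mat_eq: "generic_mat n = map_mat to_fract (poly_mat n)"
  by (intro eq_matI) (auto simp: generic_mat_def poly_mat_def coord_eq)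

lemma mat_point_generic: "v \<in> {1..n} \<times> {1..n} \<Longrightarrow> mat_point (generic_mat n) v = coord v"
  by (auto simp: mat_point_def generic_mat_def)

context comm_ring_hom
begin

lemma mpoly_eval_var: "mpoly_eval hom y (mpoly_var v) = y v"
  by (simp add: mpoly_var_def mpoly_eval_single)

lemma mpoly_eval_const: "mpoly_eval hom y (mpoly_const a) = hom a"
  by (simp add: mpoly_eval_single)

lemma eval_poly_mat: "map_mat (mpoly_eval hom y) (poly_mat n) = mat n n (\<lambda>(a, b). y (Suc a, Suc b))"
  by (intro eq_matI) (auto simp: poly_mat_def mpoly_eval_var)

lemma eval_poly_mat_point:
  "Y \<in> carrier_mat n n \<Longrightarrow> map_mat (mpoly_eval hom (mat_point Y)) (poly_mat n) = Y"
  unfolding eval_poly_mat by (intro eq_matI) (auto simp: mat_point_def)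

lemma row_det_hom: "hom (row_det m r b y) = row_det m r (\<lambda>i j. hom (b i j)) (\<lambda>j. hom (y j))"
  unfolding row_det_def hom_det[symmetric]
  by (rule arg_cong[of _ _ det]) (auto intro!: eq_matI)

lemma low_minor_hom: "A \<in> carrier_mat n n \<Longrightarrow> low_minor n (map_mat hom A) k = hom (low_minor n A k)"
  unfolding low_minor_def hom_det[symmetric]
  by (rule arg_cong[of _ _ det]) (auto intro!: eq_matI)

lemma pairing_hom:
  assumes A: "A \<in> carrier_mat n n" and "i < n" "k < n"
  shows "pairing n (map_mat hom A) i k = hom (pairing n A i k)"
proof -
  have "col_minor n (map_mat hom A) i j = hom (col_minor n A i j)" if "j < n" for j
    unfolding col_minor_def row_det_hom
    using assms that by (intro row_det_cong) auto
  moreover have "row_minor n (map_mat hom A) j k = hom (row_minor n A j k)" if "j < n" for j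
    unfolding row_minor_def row_det_hom
    using assms that by (intro row_det_cong) auto
  ultimately show ?thesis
    using assms unfolding pairing_def hom_sum hom_mult
    by (intro sum.cong arg_cong2[of _ _ _ _ "(*)"]) auto
qed

lemma adj_mat_hom:
  assumes "A \<in> carrier_mat n n"
  shows "map_mat hom (adj_mat A) = adj_mat (map_mat hom A)"
proof (rule eq_matI)
  fix i j assume "i < dim_row (adj_mat (map_mat hom A))" "j < dim_col (adj_mat (map_mat hom A))"
  then have ij: "i < n" "j < n" using assms by (auto simp: adj_mat_def)
  have "mat_delete (map_mat hom A) j i = map_mat hom (mat_delete A j i)"
    using assms ij by (intro eq_matI) (auto simp: mat_delete_def)
  then show "map_mat hom (adj_mat A) $$ (i, j) = adj_mat (map_mat hom A) $$ (i, j)"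
    using assms ij by (simp add: adj_mat_def cofactor_def hom_distribs)
qed (use assms in \<open>auto simp: adj_mat_def\<close>)

lemma mat_conj_hom:
  assumes "h \<in> carrier_mat n n" "A \<in> carrier_mat n n"
  shows "map_mat hom (mat_conj h A) = mat_conj (map_mat hom h) (map_mat hom A)"
  unfolding mat_conj_def adj_mat_hom[OF assms(1), symmetric]
  using assms adj_mat(1)[OF assms(1)]
  by (simp add: mat_hom_mult[of _ n n _ n] mult_carrier_mat[of _ n n])

end

lemma mat_point_map_mat:
  assumes "A \<in> carrier_mat n n" "v \<in> {1..n} \<times> {1..n}"
  shows "mat_point (map_mat f A) v = f (mat_point A v)"
  using assms by (auto simp: mat_point_def)

lemma UT_map_mat:
  assumes "comm_ring_hom f" "h \<in> UT n"
  shows "map_mat f h \<in> UT n"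
proof -
  interpret comm_ring_hom f by fact
  show ?thesis
    using UT_carrier[OF assms(2)] by (intro UT_I) (auto simp: UT_index[OF assms(2)])
qed

lemma mpoly_eval_generic:
  "mpoly_vars p \<subseteq> {1..n} \<times> {1..n} \<Longrightarrow> mpoly_eval const (mat_point (generic_mat n)) p = to_fract p"
  unfolding mpoly_eval_coord[symmetric] by (rule mpoly_eval_cong) (rule mat_point_generic, blast)

text \<open>One specialization suffices: a slice matrix with all corner minors equal to 1.\<close>

lemma low_minor_generic_nonzero:
  assumes "k \<le> n"
  shows "low_minor n (generic_mat n :: 'k::field ratfun mat) k \<noteq> 0"
proof (cases "k = n")
  case False
  interpret c: inj_comm_ring_hom "const :: 'k \<Rightarrow> 'k ratfun" by (rule const_hom)
  interpret f: inj_comm_ring_hom "to_fract :: (nat \<times> nat, 'k) mpoly \<Rightarrow> 'k ratfun" by (rule to_fract_hom)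
  obtain Y :: "'k ratfun mat" where Y: "anti_lower n Y" "\<forall>k<n. low_minor n Y k = 1"
    using exists_anti_lower[of n "\<lambda>_. 1" "\<lambda>_ _. 0"] by auto
  interpret e: comm_ring_hom "mpoly_eval const (mat_point Y) :: (nat \<times> nat, 'k) mpoly \<Rightarrow> 'k ratfun"
    by (rule c.mpoly_eval_comm_ring_hom)
  have "mpoly_eval const (mat_point Y) (low_minor n (poly_mat n) k) = low_minor n Y k"
    using Y(1) by (simp add: e.low_minor_hom[symmetric] c.eval_poly_mat_point anti_lower_def)
  also have "\<dots> = 1" using Y(2) False assms by auto
  finally have "low_minor n (poly_mat n :: (nat \<times> nat, 'k) mpoly mat) k \<noteq> 0" by auto
  then show ?thesis by (simp add: generic_mat_eq f.low_minor_hom)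
qed (simp add: low_minor_full)

section \<open>Invariance of the generators\<close>

text \<open>\<open>ratfun_eval\<close> respects the operations only where denominators survive, so
  the laws are stated relative to a subfield \<open>F\<close>.\<close>

definition partial_hom :: "'a::field set \<Rightarrow> ('a \<Rightarrow> 'b::field) \<Rightarrow> bool" where
  "partial_hom F R \<longleftrightarrow> subfield_set F \<and> R 1 = 1 \<and>
     (\<forall>x\<in>F. \<forall>y\<in>F. R (x + y) = R x + R y \<and> R (x * y) = R x * R y)"

lemma partial_hom_id: "subfield_set F \<Longrightarrow> partial_hom F (\<lambda>x. x)"
  by (simp add: partial_hom_def)

lemma partial_hom_zero: "partial_hom F R \<Longrightarrow> R 0 = 0"
  using subfield_set_zero[of F] by (fastforce simp: partial_hom_def)

lemma partial_hom_uminus: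
  assumes "partial_hom F R" "x \<in> F"
  shows "R (- x) = - R x"
proof -
  have "- x \<in> F" using assms subfield_set_uminus by (auto simp: partial_hom_def)
  then have "R (- x + x) = R (- x) + R x" using assms unfolding partial_hom_def by blast
  then show ?thesis using partial_hom_zero[OF assms(1)] by (simp add: eq_neg_iff_add_eq_0)
qed

lemma partial_hom_inverse:
  assumes "partial_hom F R" "x \<in> F"
  shows "R (inverse x) = inverse (R x)"
proof (cases "x = 0")
  case True
  then show ?thesis using partial_hom_zero[OF assms(1)] by simp
next
  case False
  have "inverse x \<in> F" using assms subfield_set_inverse by (auto simp: partial_hom_def)
  then have "R (inverse x * x) = R (inverse x) * R x" "R 1 = 1"
    using assms unfolding partial_hom_def by blast+
  with False have "R x * R (inverse x) = 1" by (simp add: mult.commute)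
  then show ?thesis by (metis inverse_unique)
qed

lemma subfield_set_equalizer:
  assumes "partial_hom F R" "partial_hom F R'"
  shows "subfield_set {x \<in> F. R x = R' x}"
  using assms partial_hom_uminus[OF assms(1)] partial_hom_uminus[OF assms(2)]
    partial_hom_inverse[OF assms(1)] partial_hom_inverse[OF assms(2)]
  by (auto simp: subfield_set_def partial_hom_def)

lemma subfield_set_vimage:
  assumes h: "partial_hom F R" and G: "subfield_set G"
  shows "subfield_set {x \<in> F. R x \<in> G}"
  using h G partial_hom_uminus[OF h] partial_hom_inverse[OF h]
  by (auto simp: subfield_set_def partial_hom_def)

lemma Fract_eq_divide: "Fract p q = to_fract p / to_fract q"
  by (simp add: to_fract_def divide_fract)

lemma Fract_in_adjoin:
  assumes "mpoly_vars p \<subseteq> V" "mpoly_vars q \<subseteq> V"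
  shows "Fract p q \<in> adjoin (coord ` V)"
proof -
  have "to_fract r \<in> adjoin (coord ` V)" if "mpoly_vars r \<subseteq> V" for r :: "(nat \<times> nat, 'a) mpoly"
    unfolding mpoly_eval_coord[symmetric] using that
    by (intro subfield_set_mpoly_eval subfield_set_adjoin const_in_adjoin in_adjoin) auto
  then show ?thesis
    using assms by (simp add: Fract_eq_divide subfield_set_divide[OF subfield_set_adjoin])
qed

lemma partial_hom_ratfun_eval:
  fixes c :: "'k::field \<Rightarrow> 'b::field"
  assumes c: "comm_ring_hom c"
    and nz: "\<And>q. q \<noteq> 0 \<Longrightarrow> mpoly_vars q \<subseteq> V \<Longrightarrow> mpoly_eval c y q \<noteq> 0"
  shows "partial_hom (adjoin (coord ` V)) (ratfun_eval c y)"
  unfolding partial_hom_def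
proof (intro conjI ballI subfield_set_adjoin)
  interpret c: comm_ring_hom c by fact
  interpret e: comm_ring_hom "mpoly_eval c y :: (nat \<times> nat, 'k) mpoly \<Rightarrow> 'b"
    by (rule c.mpoly_eval_comm_ring_hom)
  show "ratfun_eval c y 1 = 1"
    unfolding One_fract_def by (subst ratfun_eval_Fract[OF c]) auto
  fix f g :: "'k ratfun" assume "f \<in> adjoin (coord ` V)" "g \<in> adjoin (coord ` V)"
  then obtain p q r s where f: "f = Fract p q" "q \<noteq> 0" "mpoly_vars q \<subseteq> V"
    and g: "g = Fract r s" "s \<noteq> 0" "mpoly_vars s \<subseteq> V"
    using adjoin_coord_Fract by meson
  have q: "mpoly_eval c y q \<noteq> 0" and s: "mpoly_eval c y s \<noteq> 0"
    using nz f g by auto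
  then have qs: "mpoly_eval c y (q * s) \<noteq> 0" by (simp add: e.hom_mult)
  show "ratfun_eval c y (f + g) = ratfun_eval c y f + ratfun_eval c y g"
    using f g q s by (simp add: ratfun_eval_Fract[OF c] e.hom_mult e.hom_add add_frac_eq)
  show "ratfun_eval c y (f * g) = ratfun_eval c y f * ratfun_eval c y g"
    using f g q s by (simp add: ratfun_eval_Fract[OF c] e.hom_mult)
qed

section \<open>The action as a substitution\<close>

lemma rho_eq:
  assumes g: "g \<in> UT n"
  shows "rho n g = ratfun_eval const (mat_point (mat_conj (map_mat const g) (generic_mat n)))"
proof
  fix f :: "'a ratfun"
  interpret c: inj_comm_ring_hom "const :: 'a \<Rightarrow> 'a ratfun" by (rule const_hom)
  show "rho n g f = ratfun_eval const (mat_point (mat_conj (map_mat const g) (generic_mat n))) f"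
    by (simp add: rho_def Let_def mat_point_def mat_conj_def mat_inverse_UT[OF g]
        c.adj_mat_hom[OF UT_carrier[OF g]])
qed

text \<open>Substituting the conjugate for the generic matrix is invertible: if the result vanished,
  evaluating it at the inverse conjugate \<open>Y\<close> would give back \<open>q\<close>, so
  \<open>q\<close> would be 0.\<close>

lemma eval_conj_nonzero:
  assumes g: "(g :: 'k::field mat) \<in> UT n" and q: "q \<noteq> 0" "mpoly_vars q \<subseteq> {1..n} \<times> {1..n}"
  shows "mpoly_eval const (mat_point (mat_conj (map_mat const g) (generic_mat n))) q \<noteq> 0"
proof
  interpret c: inj_comm_ring_hom "const :: 'k \<Rightarrow> 'k ratfun" by (rule const_hom)
  interpret f: inj_comm_ring_hom "to_fract :: (nat \<times> nat, 'k) mpoly \<Rightarrow> 'k ratfun" by (rule to_fract_hom)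
  interpret m: comm_ring_hom "mpoly_const :: 'k \<Rightarrow> (nat \<times> nat, 'k) mpoly" by (rule mpoly_const_hom)
  define h where "h = map_mat const g"
  have h: "h \<in> UT n" unfolding h_def by (rule UT_map_mat[OF c.comm_ring_hom_axioms g])
  \<comment> \<open>The same group element over the polynomial ring, where the vanishing becomes an
    identity of polynomials to which \<open>e\<close> can be applied.\<close>
  define hp :: "(nat \<times> nat, 'k) mpoly mat" where "hp = map_mat mpoly_const g"
  have hp: "hp \<in> carrier_mat n n" using UT_carrier[OF g] by (simp add: hp_def)
  define Y where "Y = mat_conj (adj_mat h) (generic_mat n)"
  have Y: "Y \<in> carrier_mat n n" using UT_carrier[OF adj_mat_in_UT[OF h]] by (simp add: Y_def)
  define e where "e = (mpoly_eval const (mat_point Y) :: (nat \<times> nat, 'k) mpoly \<Rightarrow> 'k ratfun)"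
  interpret e: comm_ring_hom e unfolding e_def by (rule c.mpoly_eval_comm_ring_hom)
  have ec: "e (mpoly_const a) = const a" for a by (simp add: e_def c.mpoly_eval_const)
  have h_fract: "map_mat to_fract hp = h"
    by (intro eq_matI) (auto simp: hp_def h_def const_eq)
  assume "mpoly_eval const (mat_point (mat_conj (map_mat const g) (generic_mat n))) q = 0"
  also have "mat_conj (map_mat const g) (generic_mat n) = map_mat to_fract (mat_conj hp (poly_mat n))"
    by (simp add: f.mat_conj_hom[OF hp] h_fract generic_mat_eq h_def)
  also have "mpoly_eval const (mat_point (map_mat to_fract (mat_conj hp (poly_mat n)))) q
      = mpoly_eval const (\<lambda>v. to_fract (mat_point (mat_conj hp (poly_mat n)) v)) q"
    by (rule mpoly_eval_cong, rule mat_point_map_mat[of _ n]) (use hp q in auto)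
  finally have "mpoly_eval mpoly_const (mat_point (mat_conj hp (poly_mat n))) q = 0"
    by (simp add: mpoly_eval_to_fract)
  then have "0 = e (mpoly_eval mpoly_const (mat_point (mat_conj hp (poly_mat n))) q)" by simp
  also have "\<dots> = mpoly_eval const (\<lambda>v. e (mat_point (mat_conj hp (poly_mat n)) v)) q"
    by (simp add: e.mpoly_eval_hom ec)
  also have "\<dots> = mpoly_eval const (mat_point (map_mat e (mat_conj hp (poly_mat n)))) q"
    by (rule mpoly_eval_cong, rule mat_point_map_mat[of _ n, symmetric]) (use hp q in auto)
  also have "map_mat e (mat_conj hp (poly_mat n)) = mat_conj h Y"
  proof -
    have "map_mat e hp = h" by (intro eq_matI) (auto simp: hp_def h_def ec)
    moreover have "map_mat e (poly_mat n) = Y" unfolding e_def by (rule c.eval_poly_mat_point[OF Y])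
    ultimately show ?thesis by (simp add: e.mat_conj_hom[OF hp])
  qed
  also have "\<dots> = generic_mat n" unfolding Y_def by (rule mat_conj_adj[OF h]) simp
  also have "mpoly_eval const (mat_point (generic_mat n)) q = to_fract q"
    by (rule mpoly_eval_generic) (rule q)
  finally show False using q by simp
qed

lemma partial_hom_rho:
  assumes g: "(g :: 'k::field mat) \<in> UT n"
  shows "partial_hom (ratfun_Mat n) (rho n g)"
  unfolding ratfun_Mat_def rho_eq[OF g]
  by (rule partial_hom_ratfun_eval)
    (use inj_comm_ring_hom.axioms(1)[OF const_hom] eval_conj_nonzero[OF g] in auto)

section \<open>Base change to the algebraic closure\<close>

lemma const_to_ac_hom: "inj_comm_ring_hom (\<lambda>a :: 'k::field. const (to_ac a))"
proof -
  interpret c: inj_comm_ring_hom "const :: 'k alg_closure \<Rightarrow> 'k alg_closure ratfun" by (rule const_hom)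
  show ?thesis by unfold_locales (simp_all add: c.hom_add c.hom_mult)
qed

lemma eval_to_ac: "mpoly_eval (\<lambda>a. const (to_ac a)) y p = mpoly_eval const y (Poly_Mapping.map to_ac p)"
  by (rule mpoly_eval_map[symmetric]) (simp_all add: const_def Zero_fract_def)

lemma eval_to_ac_coord_nonzero:
  assumes "q \<noteq> 0"
  shows "mpoly_eval (\<lambda>a. const (to_ac a)) coord q \<noteq> 0"
  using assms Poly_Mapping.map_eq_zero_iff[of to_ac q]
  by (auto simp: eval_to_ac mpoly_eval_coord in_keys_iff to_fract_def Zero_fract_def eq_fract
      intro: poly_mapping_eqI)

lemma base_change_Fract:
  assumes "q \<noteq> 0"
  shows "base_change (Fract p q) = Fract (Poly_Mapping.map to_ac p) (Poly_Mapping.map to_ac q)"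
  unfolding base_change_def
  by (subst ratfun_eval_Fract[OF inj_comm_ring_hom.axioms(1)[OF const_to_ac_hom] eval_to_ac_coord_nonzero[OF assms]])
    (simp add: eval_to_ac mpoly_eval_coord Fract_eq_divide)

lemma partial_hom_base_change: "partial_hom (adjoin (coord ` V)) base_change"
  unfolding base_change_def
  by (rule partial_hom_ratfun_eval[OF inj_comm_ring_hom.axioms(1)[OF const_to_ac_hom] eval_to_ac_coord_nonzero])

lemma base_change_hom: "inj_comm_ring_hom (base_change :: 'k::field ratfun \<Rightarrow> _)"
proof -
  have "f \<in> adjoin (coord ` UNIV)" for f :: "'k ratfun"
    by (cases f) (use Fract_in_adjoin[of _ UNIV] in auto)
  then have "adjoin (coord ` UNIV) = (UNIV :: 'k ratfun set)" by blast
  then have h: "partial_hom UNIV (base_change :: 'k ratfun \<Rightarrow> _)"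
    using partial_hom_base_change[of UNIV, where ?'a = 'k] by simp
  show ?thesis
  proof
    fix x :: "'k ratfun" assume *: "base_change x = 0"
    show "x = 0"
    proof (rule ccontr)
      assume "x \<noteq> 0"
      then have "base_change (x * inverse x) = (1 :: 'k alg_closure ratfun)"
        using h by (simp add: partial_hom_def)
      then show False using h * by (simp add: partial_hom_def del: right_inverse)
    qed
  qed (use h partial_hom_zero[OF h] in \<open>auto simp: partial_hom_def\<close>)
qed

lemma map_to_ac_one: "Poly_Mapping.map to_ac (1 :: ('v, 'k::field) mpoly) = 1"
  using Poly_Mapping.map_single[of "1 :: 'k" to_ac "0 :: 'v \<Rightarrow>\<^sub>0 nat"] by simp

lemma base_change_const: "base_change (const a) = const (to_ac a)"
  unfolding const_def by (subst base_change_Fract) (auto simp: map_to_ac_one)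

lemma base_change_coord: "base_change (coord v) = coord v"
  unfolding coord_def by (subst base_change_Fract) (auto simp: map_to_ac_one)

lemma base_change_generic_mat: "map_mat base_change (generic_mat n) = generic_mat n"
  by (intro eq_matI) (auto simp: generic_mat_def base_change_coord)

section \<open>The field of the generators consists of invariants\<close>

definition gen_set :: "nat \<Rightarrow> 'k::field ratfun set" where
  "gen_set n = {pairing n (generic_mat n) i k |i k. i < n \<and> k < n \<and> n - 1 - i < k}
     \<union> {low_minor n (generic_mat n) k |k. k < n}"

lemma generic_mat_in:
  "i < n \<Longrightarrow> j < n \<Longrightarrow> generic_mat n $$ (i, j) \<in> ratfun_Mat n"
  unfolding ratfun_Mat_def by (rule in_adjoin) (auto simp: generic_mat_def)

lemma gen_set_subset: "gen_set n \<subseteq> ratfun_Mat n"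
proof -
  have S: "subfield_set (ratfun_Mat n)" unfolding ratfun_Mat_def by (rule subfield_set_adjoin)
  have "low_minor n (generic_mat n) k \<in> ratfun_Mat n" for k
    unfolding low_minor_def by (intro subfield_set_det[OF S]) (auto intro!: generic_mat_in)
  moreover have "pairing n (generic_mat n) i k \<in> ratfun_Mat n" if "i < n" "k < n" for i k
    unfolding pairing_def col_minor_def row_minor_def row_det_def using that
    by (intro subfield_set_sum[OF S] subfield_set_mult[OF S] subfield_set_det[OF S])
      (auto intro!: generic_mat_in)
  ultimately show ?thesis by (auto simp: gen_set_def)
qed

text \<open>A generator is a polynomial, so \<open>rho\<close> evaluates it at the conjugate matrix,
  which gives the same minor or pairing of the conjugate.\<close>

lemma rho_gen_set:
  assumes g: "(g :: 'k::field mat) \<in> UT n" and f: "f \<in> gen_set n"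
  shows "rho n g f = f"
proof -
  interpret c: inj_comm_ring_hom "const :: 'k \<Rightarrow> 'k ratfun" by (rule const_hom)
  interpret f: inj_comm_ring_hom "to_fract :: (nat \<times> nat, 'k) mpoly \<Rightarrow> 'k ratfun" by (rule to_fract_hom)
  define h where "h = map_mat const g"
  have h: "h \<in> UT n" unfolding h_def by (rule UT_map_mat[OF c.comm_ring_hom_axioms g])
  define Y where "Y = mat_conj h (generic_mat n)"
  have Y: "Y \<in> carrier_mat n n" using UT_carrier[OF h] by (simp add: Y_def)
  define e where "e = (mpoly_eval const (mat_point Y) :: (nat \<times> nat, 'k) mpoly \<Rightarrow> 'k ratfun)"
  interpret e: comm_ring_hom e unfolding e_def by (rule c.mpoly_eval_comm_ring_hom)
  have eY: "map_mat e (poly_mat n) = Y" unfolding e_def by (rule c.eval_poly_mat_point[OF Y])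
  have rho: "rho n g (to_fract p) = e p" for p
    unfolding rho_eq[OF g] to_fract_def h_def[symmetric] Y_def[symmetric]
    by (subst ratfun_eval_Fract[OF c.comm_ring_hom_axioms])
      (use e.hom_one in \<open>auto simp: e_def\<close>)
  from f consider i k where "f = pairing n (generic_mat n) i k" "i < n" "k < n"
    | k where "f = low_minor n (generic_mat n) k" "k < n" by (auto simp: gen_set_def)
  then show ?thesis
  proof cases
    case (1 i k)
    have "rho n g f = e (pairing n (poly_mat n) i k)"
      using 1 by (simp add: generic_mat_eq f.pairing_hom rho)
    also have "\<dots> = pairing n Y i k" using 1 by (simp add: e.pairing_hom[symmetric] eY)
    also have "\<dots> = f" unfolding Y_def 1(1)
      using 1 by (intro pairing_conj[OF h] low_minor_generic_nonzero) auto
    finally show ?thesis .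
  next
    case (2 k)
    have "rho n g f = e (low_minor n (poly_mat n) k)"
      using 2 by (simp add: generic_mat_eq f.low_minor_hom rho)
    also have "\<dots> = low_minor n Y k" by (simp add: e.low_minor_hom[symmetric] eY)
    also have "\<dots> = f" unfolding Y_def 2(1) using 2 by (intro low_minor_conj[OF h]) auto
    finally show ?thesis .
  qed
qed

lemma base_change_gen_set: "f \<in> gen_set n \<Longrightarrow> base_change f \<in> gen_set n"
proof -
  interpret b: inj_comm_ring_hom "base_change :: 'a ratfun \<Rightarrow> 'a alg_closure ratfun"
    by (rule base_change_hom)
  show "f \<in> gen_set n \<Longrightarrow> base_change f \<in> gen_set n"
    by (auto simp: gen_set_def b.low_minor_hom[of _ n, symmetric] b.pairing_hom[of _ n, symmetric]
        base_change_generic_mat; blast)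
qed

lemma rho_const: "g \<in> UT n \<Longrightarrow> rho n g (const a) = const (a :: 'k::field)"
proof -
  assume g: "g \<in> UT n"
  interpret c: inj_comm_ring_hom "const :: 'k \<Rightarrow> 'k ratfun" by (rule const_hom)
  have one: "mpoly_eval const y 1 = (1 :: 'k ratfun)" for y
    using c.mpoly_eval_const[of y 1] by simp
  show ?thesis
    unfolding rho_eq[OF g] const_def[of a]
    by (subst ratfun_eval_Fract[OF c.comm_ring_hom_axioms]) (auto simp: one c.mpoly_eval_const const_def)
qed

text \<open>The fixed elements form a subfield, so constants and generators are enough.\<close>

lemma adjoin_gen_set_rho:
  assumes g: "(g :: 'k::field mat) \<in> UT n"
  shows "adjoin (gen_set n) \<subseteq> {f \<in> ratfun_Mat n. rho n g f = f}"
proof (rule adjoin_least)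
  show "subfield_set {f \<in> ratfun_Mat n. rho n g f = f}"
    using partial_hom_rho[OF g]
    by (intro subfield_set_equalizer partial_hom_id) (auto simp: partial_hom_def)
  show "range const \<subseteq> {f \<in> ratfun_Mat n. rho n g f = f}"
    by (auto simp: rho_const[OF g] ratfun_Mat_def const_in_adjoin)
  show "gen_set n \<subseteq> {f \<in> ratfun_Mat n. rho n g f = f}"
    using gen_set_subset rho_gen_set[OF g] by blast
qed

text \<open>\<open>invariants\<close> tests invariance after base change, so the generated field has
  to be carried into its counterpart over the algebraic closure.\<close>

lemma adjoin_gen_set_base_change:
  "adjoin (gen_set n) \<subseteq> {f \<in> ratfun_Mat n :: 'k::field ratfun set. base_change f \<in> adjoin (gen_set n)}"
proof (rule adjoin_least)
  show "subfield_set {f \<in> ratfun_Mat n :: 'k ratfun set. base_change f \<in> adjoin (gen_set n)}"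
    unfolding ratfun_Mat_def by (rule subfield_set_vimage[OF partial_hom_base_change subfield_set_adjoin])
  show "range const \<subseteq> {f \<in> ratfun_Mat n :: 'k ratfun set. base_change f \<in> adjoin (gen_set n)}"
    by (auto simp: base_change_const ratfun_Mat_def const_in_adjoin)
  show "gen_set n \<subseteq> {f \<in> ratfun_Mat n :: 'k ratfun set. base_change f \<in> adjoin (gen_set n)}"
    using gen_set_subset base_change_gen_set in_adjoin by blast
qed

lemma adjoin_subset_invariants: "adjoin (gen_set n) \<subseteq> invariants n"
  using adjoin_gen_set_base_change[of n] adjoin_gen_set_rho[of _ n] unfolding invariants_def by blast

lemma adjoin_subset_invariants_points: "adjoin (gen_set n) \<subseteq> (invariants_points n :: 'k::field ratfun set)"
  \<comment> \<open>The identity of the group serves to extract the inclusion in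
    \<open>ratfun_Mat n\<close>.\<close>
  using adjoin_gen_set_rho[OF one_UT[of n], where ?'k = 'k] adjoin_gen_set_rho[of _ n, where ?'k = 'k]
  unfolding invariants_points_def by blast

section \<open>The field of invariants\<close>

text \<open>Corner minors and pairings of the slice point equal those of the generic matrix, and the
  slice formulas express all its entries rationally through them.\<close>

lemma generic_section:
  "\<exists>u\<in>UT n. \<forall>i<n. \<forall>j<n. mat_conj u (generic_mat n) $$ (i, j) \<in> (adjoin (gen_set n) :: 'k::field ratfun set)"
proof -
  define E where "E = (adjoin (gen_set n) :: 'k ratfun set)"
  have E: "subfield_set E" unfolding E_def by (rule subfield_set_adjoin)
  have nz: "low_minor n (generic_mat n :: 'k ratfun mat) k \<noteq> 0" if "k \<le> n" for k
    using that by (rule low_minor_generic_nonzero)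
  obtain u where u: "u \<in> UT n" and Y: "anti_lower n (mat_conj u (generic_mat n :: 'k ratfun mat))"
    using exists_conj_anti_lower[OF generic_mat_carrier nz] by blast
  define Y where "Y = mat_conj u (generic_mat n :: 'k ratfun mat)"
  note Y = Y[folded Y_def]
  have low_eq: "low_minor n Y k = low_minor n (generic_mat n) k" if "k < n" for k
    unfolding Y_def using that by (intro low_minor_conj[OF u]) auto
  have low: "low_minor n Y k \<in> E" "low_minor n Y k \<noteq> 0" if "k \<le> n" for k
  proof -
    have "low_minor n Y k \<in> E \<and> low_minor n Y k \<noteq> 0"
    proof (cases "k = n")
      case True
      then show ?thesis using subfield_set_one[OF E] by (simp add: low_minor_full)
    next
      case False
      with that have "k < n" by simp
      then show ?thesis
        using nz[of k] by (auto simp: low_eq E_def gen_set_def intro!: in_adjoin)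
    qed
    then show "low_minor n Y k \<in> E" "low_minor n Y k \<noteq> 0" by auto
  qed
  have pair: "pairing n Y i k \<in> E" if "i < n" "k < n" "n - 1 - i < k" for i k
  proof -
    have "pairing n Y i k = pairing n (generic_mat n) i k"
      unfolding Y_def using that nz by (intro pairing_conj[OF u]) auto
    then show ?thesis using that by (auto simp: E_def gen_set_def intro!: in_adjoin)
  qed
  have diag: "Y $$ (i, n - 1 - i) \<in> E" "Y $$ (i, n - 1 - i) \<noteq> 0" if "i < n" for i
  proof -
    have *: "low_minor n Y i = (-1) ^ (n - 1 - i) * Y $$ (i, n - 1 - i) * low_minor n Y (Suc i)"
      by (rule low_minor_anti_lower[OF Y that])
    then show "Y $$ (i, n - 1 - i) \<noteq> 0" using low(2)[of i] that by auto
    \<comment> \<open>The sign squares to 1, which allows solving the recursion for the antidiagonal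
      entry.\<close>
    have "((-1) ^ (n - 1 - i) :: 'k ratfun) * (-1) ^ (n - 1 - i) = 1"
      by (simp flip: power_mult_distrib)
    then have "Y $$ (i, n - 1 - i) = (-1) ^ (n - 1 - i) * low_minor n Y i / low_minor n Y (Suc i)"
      using * low(2)[of "Suc i"] that by (simp add: mult.assoc[symmetric])
    moreover have "(-1) ^ (n - 1 - i) \<in> E"
      by (intro subfield_set_power[OF E] subfield_set_uminus[OF E] subfield_set_one[OF E])
    ultimately show "Y $$ (i, n - 1 - i) \<in> E"
      using low(1)[of i] low(1)[of "Suc i"] that
      by (auto intro!: subfield_set_divide[OF E] subfield_set_mult[OF E])
  qed
  have "Y $$ (i, j) \<in> E" if ij: "i < n" "j < n" for i j
  proof (cases j "n - 1 - i" rule: linorder_cases)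
    case less
    then have "Y $$ (i, j) = 0" using Y by (simp add: anti_lower_def)
    then show ?thesis using subfield_set_zero[OF E] by simp
  next
    case equal
    then show ?thesis using diag(1)[OF ij(1)] by simp
  next
    case greater
    have "Y $$ (i, j) = pairing n Y i j * Y $$ (i, n - 1 - i) / (low_minor n Y i * low_minor n Y j)"
      using pairing_anti_lower[OF Y ij low(2)] diag(2)[OF ij(1)] low(2)[of i] low(2)[of j] ij by simp
    then show ?thesis
      using diag(1)[OF ij(1)] low(1)[of i] low(1)[of j] pair[OF ij greater] ij
      by (auto intro!: subfield_set_divide[OF E] subfield_set_mult[OF E])
  qed
  with u show ?thesis by (auto simp: Y_def E_def)
qed

lemma inj_coord_power: "inj (\<lambda>m. (coord v :: 'k::field ratfun) ^ m)"
proof (rule injI)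
  interpret f: inj_comm_ring_hom "to_fract :: (nat \<times> nat, 'k) mpoly \<Rightarrow> 'k ratfun" by (rule to_fract_hom)
  fix a b assume "(coord v :: 'k ratfun) ^ a = coord v ^ b"
  then have "to_fract ((mpoly_var v :: (nat \<times> nat, 'k) mpoly) ^ a) = to_fract (mpoly_var v ^ b)"
    by (simp add: coord_eq f.hom_power)
  then have "(mpoly_var v :: (nat \<times> nat, 'k) mpoly) ^ a = mpoly_var v ^ b"
    by (simp add: to_fract_def eq_fract)
  then have "Poly_Mapping.keys ((mpoly_var v :: (nat \<times> nat, 'k) mpoly) ^ a)
      = Poly_Mapping.keys ((mpoly_var v :: (nat \<times> nat, 'k) mpoly) ^ b)" by simp
  then have "Poly_Mapping.single v a = Poly_Mapping.single v b" by (simp add: mpoly_var_power)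
  then show "a = b" by (metis lookup_single_eq)
qed

text \<open>The last corner minor is the coordinate \<open>x_n1\<close>, whose powers are pairwise
  distinct, also over a finite \<open>K\<close>.\<close>

lemma infinite_adjoin_gen_set:
  assumes "n \<ge> 1"
  shows "infinite (adjoin (gen_set n) :: 'k::field ratfun set)"
proof -
  have "low_minor n (generic_mat n :: 'k ratfun mat) (n - 1) = coord (n, 1)"
    unfolding low_minor_def using assms by (subst det_single) (auto simp: generic_mat_def)
  moreover have "low_minor n (generic_mat n :: 'k ratfun mat) (n - 1) \<in> gen_set n"
    using assms by (auto simp: gen_set_def)
  ultimately have "(coord (n, 1) :: 'k ratfun) \<in> adjoin (gen_set n)"
    by (auto intro: in_adjoin)
  then have "range (\<lambda>m. (coord (n, 1) :: 'k ratfun) ^ m) \<subseteq> adjoin (gen_set n)"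
    by (auto intro: subfield_set_power[OF subfield_set_adjoin])
  then show ?thesis
    using inj_coord_power range_inj_infinite finite_subset by blast
qed

text \<open>
  The denominator \<open>q\<close> may vanish on the slice. Therefore the slice point \<open>Y\<close> is moved by some \<open>h\<close> with
  entries in the field \<open>E\<close> of the generators such that \<open>q\<close> does not vanish at the conjugate; this is
  possible as \<open>E\<close> is infinite, even if \<open>K\<close> is finite.
\<close>

lemma invariant_in_adjoin:
  fixes p q :: "(nat \<times> nat, 'k::field) mpoly"
  assumes n: "n \<ge> 1" and q0: "q \<noteq> 0"
    and p: "mpoly_vars p \<subseteq> {1..n} \<times> {1..n}" and q: "mpoly_vars q \<subseteq> {1..n} \<times> {1..n}"
    and inv: "\<And>h. h \<in> UT n \<Longrightarrow> mpoly_eval const (mat_point (mat_conj h (generic_mat n))) p * to_fract q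
       = to_fract p * mpoly_eval const (mat_point (mat_conj h (generic_mat n))) q"
  shows "Fract p q \<in> adjoin (gen_set n)"
proof -
  define E where "E = (adjoin (gen_set n) :: 'k ratfun set)"
  have E: "subfield_set E" unfolding E_def by (rule subfield_set_adjoin)
  have infE: "infinite E" unfolding E_def by (rule infinite_adjoin_gen_set[OF n])
  define Z where "Z = (generic_mat n :: 'k ratfun mat)"
  have Z: "Z \<in> carrier_mat n n" by (simp add: Z_def)
  obtain u where u: "u \<in> UT n" and uE: "\<And>i j. i < n \<Longrightarrow> j < n \<Longrightarrow> mat_conj u Z $$ (i, j) \<in> E"
    using generic_section[of n, where ?'k = 'k] unfolding E_def Z_def by blast
  define Y where "Y = mat_conj u Z"
  have Y: "Y \<in> carrier_mat n n" using UT_carrier[OF u] Z by (simp add: Y_def)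
  define F where "F h = mpoly_eval const (mat_point (mat_conj h Y)) q" for h
  \<comment> \<open>Conjugating back from the slice recovers the generic matrix. Thus
    \<open>F\<close> is not identically 0 on the group, and by density it is nonzero at some
    \<open>h\<close> with entries in \<open>E\<close>.\<close>
  have "F (adj_mat u) = to_fract q"
    using mat_conj_adj(1)[OF u Z] mpoly_eval_generic[OF q] by (simp add: F_def Y_def Z_def)
  then have "F (adj_mat u) \<noteq> 0" using q0 by simp
  moreover have "F (adj_mat u) = 0"
    if "\<And>h. h \<in> UT n \<Longrightarrow> (\<And>a b. a < b \<Longrightarrow> b < n \<Longrightarrow> h $$ (a, b) \<in> E) \<Longrightarrow> F h = 0"
    by (rule UT_density[OF _ infE that adj_mat_in_UT[OF u]])
      (auto simp: F_def intro!: sep_poly_eval_conj[OF Y q])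
  ultimately obtain h where h: "h \<in> UT n" "F h \<noteq> 0"
    and hE: "\<And>a b. a < b \<Longrightarrow> b < n \<Longrightarrow> h $$ (a, b) \<in> E" by blast
  have hE': "h $$ (a, b) \<in> E" if "a < n" "b < n" for a b
    using hE[of a b] UT_index[OF h(1) that(1), of b] that subfield_set_one[OF E] subfield_set_zero[OF E]
    by (cases "a < b") auto
  have ZE: "mat_conj h Y $$ (i, j) \<in> E" if "i < n" "j < n" for i j
    by (rule subfield_set_mat_conj[OF E UT_carrier[OF h(1)] Y hE' uE[folded Y_def] that])
  have ev: "mpoly_eval const (mat_point (mat_conj h Y)) r \<in> E" if r: "mpoly_vars r \<subseteq> {1..n} \<times> {1..n}" for r
  proof (rule subfield_set_mpoly_eval[OF E])
    show "const a \<in> E" for a unfolding E_def by (rule const_in_adjoin)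
    fix v assume "v \<in> mpoly_vars r"
    with r obtain i j where "v = (i, j)" "i \<in> {1..n}" "j \<in> {1..n}" by blast
    then show "mat_point (mat_conj h Y) v \<in> E" using ZE[of "i - 1" "j - 1"] by (auto simp: mat_point_def)
  qed
  \<comment> \<open>The moved slice point is the conjugate of the generic matrix by one group
    element, so \<open>inv\<close> applies to it.\<close>
  have "mat_conj (u * h) Z = mat_conj h Y" unfolding Y_def by (rule mat_conj_mult[OF u h(1) Z])
  then have "mpoly_eval const (mat_point (mat_conj h Y)) p * to_fract q = to_fract p * F h"
    using inv[OF UT_mult[OF u h(1)]] by (simp add: Z_def F_def)
  then have "Fract p q = mpoly_eval const (mat_point (mat_conj h Y)) p / F h"
    using h(2) q0 by (simp add: Fract_eq_divide frac_eq_eq mult.commute)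
  also have "\<dots> \<in> E" unfolding F_def by (intro subfield_set_divide[OF E] ev p q)
  finally show ?thesis by (simp add: E_def)
qed

lemma UT_const_entries:
  fixes h :: "'k::field ratfun mat"
  assumes h: "h \<in> UT n" and "\<And>a b. a < b \<Longrightarrow> b < n \<Longrightarrow> h $$ (a, b) \<in> range const"
  obtains g where "g \<in> UT n" "h = map_mat const g"
proof -
  interpret c: inj_comm_ring_hom "const :: 'k \<Rightarrow> 'k ratfun" by (rule const_hom)
  define g where "g = unitri n (\<lambda>(a, b). inv_into UNIV const (h $$ (a, b)))"
  have "h = map_mat const g"
  proof (rule eq_matI)
    fix a b assume "a < dim_row (map_mat const g)" "b < dim_col (map_mat const g)"
    then have ab: "a < n" "b < n" by (auto simp: g_def unitri_def)
    show "h $$ (a, b) = map_mat const g $$ (a, b)"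
    proof (cases "a < b")
      case True
      then have "const (inv_into UNIV const (h $$ (a, b))) = h $$ (a, b)"
        using assms(2) ab by (intro f_inv_into_f) auto
      then show ?thesis using True ab by (simp add: g_def unitri_def)
    next
      case False
      then show ?thesis using UT_index[OF h ab(1), of b] ab by (auto simp: g_def unitri_def)
    qed
  qed (use UT_carrier[OF h] in \<open>auto simp: g_def unitri_def\<close>)
  moreover have "g \<in> UT n" unfolding g_def by (rule unitri_UT)
  ultimately show ?thesis using that by simp
qed

text \<open>For a constant matrix the identity is invariance with denominators cleared. The
  constants are infinite in number, so density extends it to matrices over the function
  field.\<close>

lemma invariant_eval_identity:
  fixes p q :: "(nat \<times> nat, 'k::field) mpoly"
  assumes q0: "q \<noteq> 0" and p: "mpoly_vars p \<subseteq> {1..n} \<times> {1..n}" and q: "mpoly_vars q \<subseteq> {1..n} \<times> {1..n}"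
    and K: "infinite (UNIV :: 'k set)"
    and inv: "\<And>g. g \<in> UT n \<Longrightarrow> rho n g (Fract p q) = Fract p q"
    and h: "h \<in> UT n"
  shows "mpoly_eval const (mat_point (mat_conj h (generic_mat n))) p * to_fract q
       = to_fract p * mpoly_eval const (mat_point (mat_conj h (generic_mat n))) q"
proof (rule eval_conj_identity_density[OF generic_mat_carrier p q _ _ h])
  interpret c: inj_comm_ring_hom "const :: 'k \<Rightarrow> 'k ratfun" by (rule const_hom)
  have "inj (const :: 'k \<Rightarrow> 'k ratfun)" by (auto intro: injI simp: c.eq_iff)
  then show "infinite (range (const :: 'k \<Rightarrow> 'k ratfun))" using K finite_imageD by blast
  fix h :: "'k ratfun mat"
  assume "h \<in> UT n" "\<And>a b. a < b \<Longrightarrow> b < n \<Longrightarrow> h $$ (a, b) \<in> range const"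
  then obtain g where g: "g \<in> UT n" and hg: "h = map_mat const g" by (rule UT_const_entries)
  have nz: "mpoly_eval const (mat_point (mat_conj h (generic_mat n))) q \<noteq> 0"
    unfolding hg by (rule eval_conj_nonzero[OF g q0 q])
  have "mpoly_eval const (mat_point (mat_conj h (generic_mat n))) p
      / mpoly_eval const (mat_point (mat_conj h (generic_mat n))) q = to_fract p / to_fract q"
    using inv[OF g] ratfun_eval_Fract[OF c.comm_ring_hom_axioms nz, of p]
    by (simp add: rho_eq[OF g] hg Fract_eq_divide)
  then show "mpoly_eval const (mat_point (mat_conj h (generic_mat n))) p * to_fract q
       = to_fract p * mpoly_eval const (mat_point (mat_conj h (generic_mat n))) q"
    using nz q0 by (simp add: frac_eq_eq)
qed

lemma invariants_points_subset:
  assumes n: "n \<ge> 1" and K: "infinite (UNIV :: 'k::field set)"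
  shows "(invariants_points n :: 'k ratfun set) \<subseteq> adjoin (gen_set n)"
proof
  fix f :: "'k ratfun" assume f: "f \<in> invariants_points n"
  then obtain p q where pq: "f = Fract p q" "q \<noteq> 0" "mpoly_vars p \<subseteq> {1..n} \<times> {1..n}" "mpoly_vars q \<subseteq> {1..n} \<times> {1..n}"
    using adjoin_coord_Fract unfolding invariants_points_def ratfun_Mat_def by blast
  show "f \<in> adjoin (gen_set n)" unfolding pq(1)
    using f by (intro invariant_in_adjoin[OF n pq(2-4)] invariant_eval_identity[OF pq(2-4) K])
      (auto simp: pq(1) invariants_points_def)
qed

text \<open>The identity is obtained over the algebraic closure, which is infinite, for the base
  change of \<open>h\<close>. Injectivity of \<open>base_change\<close> then brings it back to
  \<open>K\<close>.\<close>

lemma invariants_subset: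
  assumes n: "n \<ge> 1"
  shows "(invariants n :: 'k::field ratfun set) \<subseteq> adjoin (gen_set n)"
proof
  fix f :: "'k ratfun" assume f: "f \<in> invariants n"
  then obtain p q where pq: "f = Fract p q" "q \<noteq> 0" "mpoly_vars p \<subseteq> {1..n} \<times> {1..n}" "mpoly_vars q \<subseteq> {1..n} \<times> {1..n}"
    using adjoin_coord_Fract unfolding invariants_def ratfun_Mat_def by blast
  interpret b: inj_comm_ring_hom "base_change :: 'k ratfun \<Rightarrow> 'k alg_closure ratfun"
    by (rule base_change_hom)
  interpret f: inj_comm_ring_hom "to_fract :: (nat \<times> nat, 'k) mpoly \<Rightarrow> 'k ratfun" by (rule to_fract_hom)
  define p' q' where "p' = Poly_Mapping.map to_ac p" and "q' = Poly_Mapping.map to_ac q"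
  have bc: "base_change (mpoly_eval const y r) = mpoly_eval const (\<lambda>v. base_change (y v)) (Poly_Mapping.map to_ac r)"
    for y and r :: "(nat \<times> nat, 'k) mpoly"
    by (simp add: b.mpoly_eval_hom base_change_const eval_to_ac)
  have bc_fract: "base_change (to_fract r) = to_fract (Poly_Mapping.map to_ac r)" for r :: "(nat \<times> nat, 'k) mpoly"
    unfolding to_fract_def by (simp add: base_change_Fract map_to_ac_one)
  have q'0: "q' \<noteq> 0"
    using pq(2) bc_fract[of q] by (auto simp: q'_def)
  have vars: "mpoly_vars p' \<subseteq> {1..n} \<times> {1..n}" "mpoly_vars q' \<subseteq> {1..n} \<times> {1..n}"
    unfolding p'_def q'_def by (rule subset_trans[OF mpoly_vars_map pq(3)], rule subset_trans[OF mpoly_vars_map pq(4)])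
  have inv: "rho n g (Fract p' q') = Fract p' q'" if "g \<in> UT n" for g
    using f that by (simp add: invariants_def pq(1) base_change_Fract[OF pq(2)] p'_def q'_def)
  have "mpoly_eval const (mat_point (mat_conj h (generic_mat n))) p * to_fract q
       = to_fract p * mpoly_eval const (mat_point (mat_conj h (generic_mat n))) q" if h: "h \<in> UT n" for h
  proof -
    have h': "map_mat base_change h \<in> UT n" by (rule UT_map_mat[OF b.comm_ring_hom_axioms h])
    have eq: "mat_conj (map_mat base_change h) (generic_mat n) = map_mat base_change (mat_conj h (generic_mat n))"
      by (simp add: b.mat_conj_hom[OF UT_carrier[OF h]] base_change_generic_mat)
    have ev: "mpoly_eval const (mat_point (mat_conj (map_mat base_change h) (generic_mat n))) (Poly_Mapping.map to_ac r)
        = base_change (mpoly_eval const (mat_point (mat_conj h (generic_mat n))) r)"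
      if r: "mpoly_vars r \<subseteq> {1..n} \<times> {1..n}" for r
      unfolding bc eq using mpoly_vars_map[of to_ac r] r UT_carrier[OF h]
      by (intro mpoly_eval_cong mat_point_map_mat[of _ n]) auto
    have "base_change (mpoly_eval const (mat_point (mat_conj h (generic_mat n))) p * to_fract q)
       = base_change (to_fract p * mpoly_eval const (mat_point (mat_conj h (generic_mat n))) q)"
      using invariant_eval_identity[OF q'0 vars infinite_UNIV_alg_closed inv h']
      by (simp add: p'_def q'_def ev[OF pq(3)] ev[OF pq(4)] b.hom_mult bc_fract)
    then show ?thesis by (simp only: b.eq_iff)
  qed
  then show "f \<in> adjoin (gen_set n)" unfolding pq(1) by (rule invariant_in_adjoin[OF n pq(2-4)])
qed

section \<open>The minors in 0-based indexing\<close>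

text \<open>Exactly \<open>r\<close> elements of the image lie below \<open>f r\<close>, so an
  increasing enumeration agrees with \<open>pick\<close>.\<close>

lemma pick_strict_mono:
  assumes f: "strict_mono_on {..<m} f" and r: "r < m"
  shows "pick (f ` {..<m}) r = f r"
proof -
  have "{a \<in> f ` {..<m}. a < f r} = f ` {..<r}"
  proof (intro equalityI subsetI)
    fix a assume "a \<in> {a \<in> f ` {..<m}. a < f r}"
    then obtain s where s: "s < m" "a = f s" "f s < f r" by auto
    then have "s < r" using strict_mono_on_less[OF f, of s r] r by auto
    then show "a \<in> f ` {..<r}" using s by auto
  next
    fix a assume "a \<in> f ` {..<r}"
    then show "a \<in> {a \<in> f ` {..<m}. a < f r}"
      using r strict_mono_onD[OF f] by fastforce
  qed
  moreover have "inj_on f {..<r}"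
    using strict_mono_on_imp_inj_on[OF f] r by (auto intro: inj_on_subset)
  ultimately have "card {a \<in> f ` {..<m}. a < f r} = r" by (simp add: card_image)
  then show ?thesis using pick_card_in_set[of "f r" "f ` {..<m}"] r by simp
qed

lemma minor_eq_det:
  assumes f: "strict_mono_on {..<m} f" "f ` {..<m} = {a. Suc a \<in> R}" "f ` {..<m} \<subseteq> {..<dim_row A}"
    and g: "strict_mono_on {..<m} g" "g ` {..<m} = {b. Suc b \<in> C}" "g ` {..<m} \<subseteq> {..<dim_col A}"
  shows "minor A R C = det (mat m m (\<lambda>(r, c). A $$ (f r, g c)))"
proof -
  have "{i. i < dim_row A \<and> i \<in> f ` {..<m}} = f ` {..<m}" "{i. i < dim_col A \<and> i \<in> g ` {..<m}} = g ` {..<m}"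
    using f g by auto
  moreover have "card (f ` {..<m}) = m" "card (g ` {..<m}) = m"
    using strict_mono_on_imp_inj_on[OF f(1)] strict_mono_on_imp_inj_on[OF g(1)] by (simp_all add: card_image)
  ultimately have "submatrix A (f ` {..<m}) (g ` {..<m}) = mat m m (\<lambda>(r, c). A $$ (f r, g c))"
    using pick_strict_mono[OF f(1)] pick_strict_mono[OF g(1)]
    by (intro eq_matI) (auto simp: submatrix_def)
  then show ?thesis by (simp add: minor_def f(2)[symmetric] g(2)[symmetric])
qed

lemma image_shift: "(\<lambda>r. k + r) ` {..<m::nat} = {k..<k + m}"
proof (intro equalityI subsetI)
  fix x assume "x \<in> {k..<k + m}"
  then show "x \<in> (\<lambda>r. k + r) ` {..<m}" by (intro image_eqI[of _ _ "x - k"]) auto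
qed auto

lemma minor_D_eq:
  assumes A: "A \<in> carrier_mat n n" and k: "k < n"
  shows "minor_D n A (Suc k) = low_minor n A k"
  unfolding minor_D_def low_minor_def
  by (rule minor_eq_det) (use A k in \<open>auto simp: image_shift strict_mono_on_def opp_def\<close>)

text \<open>Since \<open>j \<le> k\<close>, putting row \<open>j\<close> first gives the increasing
  order, and there is no sign.\<close>

lemma minor_N_eq:
  assumes A: "A \<in> carrier_mat n n" and jk: "j \<le> k" "k < n"
  shows "minor_N n A (Suc j) (Suc k) = row_minor n A j k"
proof -
  let ?f = "\<lambda>r. if r = 0 then j else k + r"
  have "?f ` {..<n - k} = {a. Suc a \<in> {Suc j} \<union> {Suc k + 1..n}}"
  proof (intro equalityI subsetI)
    fix x assume "x \<in> {a. Suc a \<in> {Suc j} \<union> {Suc k + 1..n}}"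
    then have "x = j \<or> k < x \<and> x < n" by auto
    then show "x \<in> ?f ` {..<n - k}"
    proof
      assume "x = j"
      then show ?thesis using jk by (intro image_eqI[of _ _ 0]) auto
    next
      assume "k < x \<and> x < n"
      then show ?thesis using jk by (intro image_eqI[of _ _ "x - k"]) auto
    qed
  qed (use jk in auto)
  then have "minor_N n A (Suc j) (Suc k) = det (mat (n - k) (n - k) (\<lambda>(r, c). A $$ (?f r, c)))"
    unfolding minor_N_def
    by (intro minor_eq_det) (use A jk in \<open>auto simp: strict_mono_on_def opp_def\<close>)
  also have "\<dots> = row_minor n A j k"
    unfolding row_minor_def row_det_def by (rule arg_cong[of _ _ det]) (auto intro!: eq_matI)
  finally show ?thesis .
qed

text \<open>Since \<open>n - 1 - i \<le> j\<close>, column \<open>j\<close> comes last in increasing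
  order; transposition leads to the form of \<open>col_minor\<close>.\<close>

lemma minor_M_eq:
  assumes A: "A \<in> carrier_mat n n" and ij: "i < n" "j < n" "n - 1 - i \<le> j"
  shows "minor_M n A (Suc i) (Suc j) = col_minor n A i j"
proof -
  let ?g = "\<lambda>c. if c = n - i - 1 then j else c"
  have "?g ` {..<n - i} = {b. Suc b \<in> {1..opp n (Suc i) - 1} \<union> {Suc j}}"
  proof (intro equalityI subsetI)
    fix x assume "x \<in> {b. Suc b \<in> {1..opp n (Suc i) - 1} \<union> {Suc j}}"
    then have "x = j \<or> x < n - i - 1" using ij by (auto simp: opp_def)
    then show "x \<in> ?g ` {..<n - i}"
    proof
      assume "x = j"
      then show ?thesis using ij by (intro image_eqI[of _ _ "n - i - 1"]) auto
    next
      assume "x < n - i - 1"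
      then show ?thesis using ij by (intro image_eqI[of _ _ x]) auto
    qed
  qed (use ij in \<open>auto simp: opp_def\<close>)
  then have "minor_M n A (Suc i) (Suc j) = det (mat (n - i) (n - i) (\<lambda>(r, c). A $$ (i + r, ?g c)))"
    unfolding minor_M_def
    by (intro minor_eq_det) (use A ij in \<open>auto simp: image_shift strict_mono_on_def\<close>)
  also have "\<dots> = det (transpose_mat (mat (n - i) (n - i) (\<lambda>(r, c). A $$ (i + r, ?g c))))"
    by (rule det_transpose[symmetric]) auto
  also have "\<dots> = col_minor n A i j"
    unfolding col_minor_def row_det_def by (rule arg_cong[of _ _ det]) (auto intro!: eq_matI)
  finally show ?thesis .
qed

lemma poly_P_eq:
  assumes A: "A \<in> carrier_mat n n" and ik: "i < n" "k < n"
  shows "poly_P n A (Suc i) (Suc k) = pairing n A i k"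
  unfolding poly_P_def pairing_def
proof (rule sum.reindex_bij_witness[of _ Suc "\<lambda>j. j - 1"])
  fix j assume "j \<in> {opp n (Suc i)..Suc k}"
  then have j: "j = Suc (j - 1)" "n - 1 - i \<le> j - 1" "j - 1 \<le> k" using ik by (auto simp: opp_def)
  then show "Suc (j - 1) = j" "j - 1 \<in> {n - 1 - i..k}" by auto
  show "col_minor n A i (j - 1) * row_minor n A (j - 1) k = minor_M n A (Suc i) j * minor_N n A j (Suc k)"
    using minor_M_eq[OF A ik(1), of "j - 1"] minor_N_eq[OF A j(3) ik(2)] j ik by simp
qed (use ik in \<open>auto simp: opp_def\<close>)

section \<open>Algebraic independence and conclusion\<close>

abbreviation gen_index :: "nat \<Rightarrow> (nat \<times> nat + nat) set" where
  "gen_index n \<equiv> {(i, k). i \<in> {1..n} \<and> k \<in> {1..n} \<and> opp n i < k} <+> {1..n}"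

abbreviation gen :: "nat \<Rightarrow> 'a::comm_ring_1 mat \<Rightarrow> nat \<times> nat + nat \<Rightarrow> 'a" where
  "gen n A \<equiv> case_sum (\<lambda>(i, k). poly_P n A i k) (\<lambda>k. minor_D n A k)"

lemma gen_index_cases:
  assumes "v \<in> gen_index n"
  obtains i k where "v = Inl (Suc i, Suc k)" "i < n" "k < n" "n - 1 - i < k"
    | k where "v = Inr (Suc k)" "k < n"
proof -
  from assms consider i k where "v = Inl (i, k)" "i \<in> {1..n}" "k \<in> {1..n}" "opp n i < k"
    | k where "v = Inr k" "k \<in> {1..n}" by blast
  then show thesis
  proof cases
    case (1 i k)
    then show ?thesis using that(1)[of "i - 1" "k - 1"] by (auto simp: opp_def)
  next
    case (2 k)
    then show ?thesis using that(2)[of "k - 1"] by auto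
  qed
qed

lemma gen_image: "gen n (generic_mat n) ` gen_index n = gen_set n"
proof (intro equalityI subsetI)
  fix f assume "f \<in> gen n (generic_mat n) ` gen_index n"
  then obtain v where v: "v \<in> gen_index n" "f = gen n (generic_mat n) v" by blast
  from v(1) show "f \<in> gen_set n"
  proof (cases rule: gen_index_cases)
    case (1 i k)
    then have "f = pairing n (generic_mat n) i k" using v(2) by (simp add: poly_P_eq[OF generic_mat_carrier])
    then show ?thesis using 1 by (auto simp: gen_set_def)
  next
    case (2 k)
    then have "f = low_minor n (generic_mat n) k" using v(2) by (simp add: minor_D_eq[OF generic_mat_carrier])
    then show ?thesis using 2 by (auto simp: gen_set_def)
  qed
next
  fix f assume "f \<in> (gen_set n :: 'a ratfun set)"
  then consider i k where "f = pairing n (generic_mat n) i k" "i < n" "k < n" "n - 1 - i < k"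
    | k where "f = low_minor n (generic_mat n) k" "k < n" by (auto simp: gen_set_def)
  then show "f \<in> gen n (generic_mat n) ` gen_index n"
  proof cases
    case (1 i k)
    then show ?thesis
      by (intro image_eqI[of _ _ "Inl (Suc i, Suc k)"])
        (auto simp: poly_P_eq[OF generic_mat_carrier] opp_def)
  next
    case (2 k)
    then show ?thesis
      by (intro image_eqI[of _ _ "Inr (Suc k)"]) (auto simp: minor_D_eq[OF generic_mat_carrier])
  qed
qed

text \<open>The generic matrix is specialized to a slice matrix at which the generators become
  pairwise distinct variables. A relation between the generators thus becomes one between variables,
  which is trivial.\<close>

lemma alg_independent_gen: "alg_independent (gen_index n) (gen n (generic_mat n :: 'k::field ratfun mat))"
  unfolding alg_independent_def
proof (intro allI impI)
  fix p :: "(nat \<times> nat + nat, 'k) mpoly"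
  assume asm: "mpoly_vars p \<subseteq> gen_index n \<and> mpoly_eval const (gen n (generic_mat n)) p = 0"
  then have vars: "mpoly_vars p \<subseteq> gen_index n" by simp
  interpret c: inj_comm_ring_hom "const :: 'k \<Rightarrow> 'k ratfun" by (rule const_hom)
  interpret f: inj_comm_ring_hom "to_fract :: (nat \<times> nat, 'k) mpoly \<Rightarrow> 'k ratfun" by (rule to_fract_hom)
  interpret m: comm_ring_hom "mpoly_const :: 'k \<Rightarrow> (nat \<times> nat + nat, 'k) mpoly" by (rule mpoly_const_hom)
  \<comment> \<open>\<open>P\<^sub>i\<^sub>k\<close> goes to \<open>x\<^sub>i\<^sub>k\<close> below the antidiagonal, \<open>D\<^sub>k\<close> to the antidiagonal entry of row \<open>k\<close>.\<close>
  define emb :: "nat \<times> nat + nat \<Rightarrow> nat \<times> nat" where "emb = case_sum (\<lambda>v. v) (\<lambda>k. (k, opp n k))"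
  \<comment> \<open>A left inverse of \<open>emb\<close> on the index set: the strict inequality
    \<open>opp n i < k\<close> separates the pairs from the antidiagonal ones.\<close>
  define unemb :: "nat \<times> nat \<Rightarrow> nat \<times> nat + nat" where
    "unemb v = (if snd v = opp n (fst v) then Inr (fst v) else Inl v)" for v
  have unemb_emb: "unemb (emb v) = v" if "v \<in> gen_index n" for v
    using that by (auto simp: emb_def unemb_def)
  \<comment> \<open>The prescribed corner minors are coordinates, hence nonzero as
    \<open>exists_anti_lower\<close> requires.\<close>
  obtain Y :: "'k ratfun mat" where Y: "anti_lower n Y"
    and low: "\<forall>k<n. low_minor n Y k = coord (Suc k, opp n (Suc k))"
    and pair: "\<forall>i k. n - 1 - i < k \<and> i < n \<and> k < n \<longrightarrow> pairing n Y i k = coord (Suc i, Suc k)"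
  proof -
    have "coord v \<noteq> (0 :: 'k ratfun)" for v
    proof
      assume "coord v = (0 :: 'k ratfun)"
      then have "mpoly_var v = (0 :: (nat \<times> nat, 'k) mpoly)" by (simp add: coord_eq)
      then show False by (simp add: mpoly_var_def flip: keys_eq_empty)
    qed
    then show ?thesis
      using exists_anti_lower[of n "\<lambda>k. coord (Suc k, opp n (Suc k))" "\<lambda>i k. coord (Suc i, Suc k)"] that
      by blast
  qed
  define e where "e = (mpoly_eval const (mat_point Y) :: (nat \<times> nat, 'k) mpoly \<Rightarrow> 'k ratfun)"
  interpret e: comm_ring_hom e unfolding e_def by (rule c.mpoly_eval_comm_ring_hom)
  have eY: "map_mat e (poly_mat n) = Y"
    unfolding e_def using Y by (intro c.eval_poly_mat_point) (simp add: anti_lower_def)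
  have ec: "e (mpoly_const a) = const a" for a by (simp add: e_def c.mpoly_eval_const)
  have gen_fract: "gen n (generic_mat n :: 'k ratfun mat) v = to_fract (gen n (poly_mat n) v)"
    and gen_coord: "e (gen n (poly_mat n) v) = to_fract (mpoly_var (emb v))" if "v \<in> gen_index n" for v
  proof -
    from that have "gen n (generic_mat n :: 'k ratfun mat) v = to_fract (gen n (poly_mat n) v)
      \<and> e (gen n (poly_mat n) v) = to_fract (mpoly_var (emb v))"
    proof (cases rule: gen_index_cases)
      case (1 i k)
      have "e (pairing n (poly_mat n) i k) = coord (Suc i, Suc k)"
        using 1 pair by (simp add: e.pairing_hom[symmetric] eY)
      with 1 show ?thesis
        by (simp add: poly_P_eq[OF generic_mat_carrier] poly_P_eq[OF poly_mat_carrier] emb_def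
            poly_P_eq[of "map_mat to_fract (poly_mat n)" n]
            generic_mat_eq f.pairing_hom coord_eq)
    next
      case (2 k)
      have "e (low_minor n (poly_mat n) k) = coord (Suc k, opp n (Suc k))"
        using 2 low by (simp add: e.low_minor_hom[of _ n, symmetric] eY)
      with 2 show ?thesis
        by (simp add: minor_D_eq[OF generic_mat_carrier] minor_D_eq[OF poly_mat_carrier] emb_def
            minor_D_eq[of "map_mat to_fract (poly_mat n)" n]
            generic_mat_eq f.low_minor_hom coord_eq)
    qed
    then show "gen n (generic_mat n :: 'k ratfun mat) v = to_fract (gen n (poly_mat n) v)"
      "e (gen n (poly_mat n) v) = to_fract (mpoly_var (emb v))" by auto
  qed
  have "0 = mpoly_eval const (gen n (generic_mat n)) p" using asm by simp
  also have "\<dots> = mpoly_eval const (\<lambda>v. to_fract (gen n (poly_mat n) v)) p"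
    by (rule mpoly_eval_cong, rule gen_fract) (use vars in blast)
  also have "\<dots> = to_fract (mpoly_eval mpoly_const (gen n (poly_mat n)) p)"
    by (rule mpoly_eval_to_fract)
  finally have "mpoly_eval mpoly_const (gen n (poly_mat n)) p = 0" by simp
  then have "0 = e (mpoly_eval mpoly_const (gen n (poly_mat n)) p)" by simp
  also have "\<dots> = mpoly_eval const (\<lambda>v. e (gen n (poly_mat n) v)) p"
    by (simp add: e.mpoly_eval_hom ec)
  also have "\<dots> = mpoly_eval const (\<lambda>v. to_fract (mpoly_var (emb v))) p"
    by (rule mpoly_eval_cong, rule gen_coord) (use vars in blast)
  also have "\<dots> = to_fract (mpoly_eval mpoly_const (\<lambda>v. mpoly_var (emb v)) p)"
    by (rule mpoly_eval_to_fract)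
  finally have *: "mpoly_eval mpoly_const (\<lambda>v. mpoly_var (emb v)) p = (0 :: (nat \<times> nat, 'k) mpoly)" by simp
  \<comment> \<open>Renames the variables back, turning the vanishing polynomial into
    \<open>p\<close> itself.\<close>
  define r where "r = (mpoly_eval mpoly_const (\<lambda>v. mpoly_var (unemb v)) :: (nat \<times> nat, 'k) mpoly \<Rightarrow> (nat \<times> nat + nat, 'k) mpoly)"
  interpret r: comm_ring_hom r unfolding r_def by (rule m.mpoly_eval_comm_ring_hom)
  have "0 = r (mpoly_eval mpoly_const (\<lambda>v. mpoly_var (emb v)) p)" by (simp add: *)
  also have "\<dots> = mpoly_eval (\<lambda>a. r (mpoly_const a)) (\<lambda>v. r (mpoly_var (emb v))) p"
    by (rule r.mpoly_eval_hom)
  also have "\<dots> = mpoly_eval mpoly_const (\<lambda>v. mpoly_var (unemb (emb v))) p"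
    by (simp add: r_def m.mpoly_eval_const m.mpoly_eval_var)
  also have "\<dots> = mpoly_eval mpoly_const mpoly_var p"
    by (rule mpoly_eval_cong, rule arg_cong[of _ _ mpoly_var], rule unemb_emb) (use vars in blast)
  also have "\<dots> = p" by (rule mpoly_eval_mpoly_var)
  finally show "p = 0" by simp
qed

text \<open>Both fields of invariants are identified with \<open>adjoin (gen_set n)\<close>. For the
  abstract group, an infinite \<open>K\<close> provides the density of the constant points.\<close>

theorem theorem2p3:
  fixes n :: nat
  assumes "n \<ge> 1"
  shows "freely_generated (invariants n :: 'k::field ratfun set)
           ({(i, k). i \<in> {1..n} \<and> k \<in> {1..n} \<and> opp n i < k} <+> {1..n})
           (case_sum (\<lambda>(i, k). poly_P n (generic_mat n) i k)
                     (\<lambda>k. minor_D n (generic_mat n) k))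
       \<and> (infinite (UNIV :: 'k set) \<longrightarrow>
           freely_generated (invariants_points n :: 'k ratfun set)
             ({(i, k). i \<in> {1..n} \<and> k \<in> {1..n} \<and> opp n i < k} <+> {1..n})
             (case_sum (\<lambda>(i, k). poly_P n (generic_mat n) i k)
                       (\<lambda>k. minor_D n (generic_mat n) k)))"
proof -
  have "(invariants n :: 'k ratfun set) = adjoin (gen_set n)"
    using invariants_subset[OF assms] adjoin_subset_invariants by (rule equalityI)
  moreover have "(invariants_points n :: 'k ratfun set) = adjoin (gen_set n)" if "infinite (UNIV :: 'k set)"
    using invariants_points_subset[OF assms that] adjoin_subset_invariants_points by (rule equalityI)
  ultimately show ?thesis
    unfolding freely_generated_def gen_image by (intro conjI impI alg_independent_gen) auto
qed

end
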